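(* For every positive integer $n$ and for each one of the following three conditions (i), (ii), (iii), there exists a group $G$, generated by a 3-element subset $S$ consisting of elements of order $2$, such that every element of the $n$-ball of $G$ (with respect to $S$) is a torsion element, and such that $G$ satisfies the condition in question: (i) $G$ is solvable, virtually abelian, and infinite (more precisely, $G$ has a free abelian normal subgroup of finite index, the index being a power of $2$); in particular $G$ is linear. (ii) $G$ is polycyclic but not virtually nilpotent. (iii) $G$ is solvable but not polycyclic.
   Context: The $n$-ball of a group $G$ with respect to a symmetric generating subset $S$ is the set of elements of $G$ that can be written as a product of at most $n$ elements of $S$. An element is torsion if it has finite order. *)

theory Defs
  imports
    "HOL-Algebra.Solvable_Groups"
    "HOL-Algebra.Free_Abelian_Groups"
    "HOL-Algebra.Multiplicative_Group"
begin

text \<open>Intended for symmetric \<open>S\<close>: no inverses are taken in the words.\<close>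

definition word_ball :: "('a, 'm) monoid_scheme \<Rightarrow> 'a set \<Rightarrow> nat \<Rightarrow> 'a set" where
  "word_ball G S n =
    {foldr (\<otimes>\<^bsub>G\<^esub>) w \<one>\<^bsub>G\<^esub> | w. set w \<subseteq> S \<and> length w \<le> n}"

definition torsion_element :: "('a, 'm) monoid_scheme \<Rightarrow> 'a \<Rightarrow> bool" where
  "torsion_element G x \<longleftrightarrow>
    x \<in> carrier G \<and> (\<exists>k::nat. k > 0 \<and> x [^]\<^bsub>G\<^esub> k = \<one>\<^bsub>G\<^esub>)"

text \<open>A group with a finite generating set is countable, hence isomorphic to one whose carrier is a
  set of natural numbers: existence of such a group can be stated over \<^typ>\<open>nat monoid\<close>.\<close>

definition involution_gens_torsion_ball :: "nat \<Rightarrow> ('a, 'm) monoid_scheme \<Rightarrow> 'a set \<Rightarrow> bool" where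
  "involution_gens_torsion_ball n G S \<longleftrightarrow>
    group G \<and> S \<subseteq> carrier G \<and> generate G S = carrier G \<and>
    card S = 3 \<and> (\<forall>s\<in>S. group.ord G s = 2) \<and>
    (\<forall>x\<in>word_ball G S n. torsion_element G x)"

definition virtually :: "('a monoid \<Rightarrow> bool) \<Rightarrow> 'a monoid \<Rightarrow> bool" where
  "virtually P G \<longleftrightarrow>
    (\<exists>H. subgroup H G \<and> finite (rcosets\<^bsub>G\<^esub> H) \<and> P (G\<lparr>carrier := H\<rparr>))"

text \<open>The basis may be sought in the type of the group itself, since a basis of a free abelian
  group is in bijection with a subset of the group.\<close>

definition free_abelian :: "'a monoid \<Rightarrow> bool" where
  "free_abelian G \<longleftrightarrow> (\<exists>X :: 'a set. G \<cong> free_Abelian_group X)"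

definition polycyclic :: "'a monoid \<Rightarrow> bool" where
  "polycyclic G \<longleftrightarrow>
    (\<exists>(k::nat) (H :: nat \<Rightarrow> 'a set).
      H 0 = {\<one>\<^bsub>G\<^esub>} \<and> H k = carrier G \<and>
      (\<forall>i\<le>k. subgroup (H i) G) \<and>
      (\<forall>i<k. H i \<lhd> G\<lparr>carrier := H (Suc i)\<rparr> \<and>
             cyclic_group (G\<lparr>carrier := H (Suc i)\<rparr> Mod H i)))"

primrec lower_central :: "'a monoid \<Rightarrow> nat \<Rightarrow> 'a set" where
  "lower_central G 0 = carrier G"
| "lower_central G (Suc c) =
    generate G {x \<otimes>\<^bsub>G\<^esub> y \<otimes>\<^bsub>G\<^esub> inv\<^bsub>G\<^esub> x \<otimes>\<^bsub>G\<^esub> inv\<^bsub>G\<^esub> y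
                | x y. x \<in> lower_central G c \<and> y \<in> carrier G}"

definition nilpotent :: "'a monoid \<Rightarrow> bool" where
  "nilpotent G \<longleftrightarrow> (\<exists>c. lower_central G c = {\<one>\<^bsub>G\<^esub>})"

text \<open>Matrices of size \<open>m\<close> are extensional functions of the index pair, so that the field can be
  an arbitrary carrier-based one and can be quantified existentially.\<close>

definition mat_monoid :: "('k, 'm) ring_scheme \<Rightarrow> nat \<Rightarrow> (nat \<times> nat \<Rightarrow> 'k) monoid" where
  "mat_monoid F m =
    \<lparr>carrier = {..<m} \<times> {..<m} \<rightarrow>\<^sub>E carrier F,
     monoid.mult = (\<lambda>A B. \<lambda>(i, j) \<in> {..<m} \<times> {..<m}.
                      \<Oplus>\<^bsub>F\<^esub>k\<in>{..<m}. A (i, k) \<otimes>\<^bsub>F\<^esub> B (k, j)),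
     one = (\<lambda>(i, j) \<in> {..<m} \<times> {..<m}. if i = j then \<one>\<^bsub>F\<^esub> else \<zero>\<^bsub>F\<^esub>)\<rparr>"

definition GL :: "('k, 'm) ring_scheme \<Rightarrow> nat \<Rightarrow> (nat \<times> nat \<Rightarrow> 'k) monoid" where
  "GL F m = units_of (mat_monoid F m)"

text \<open>Up to isomorphism, the fields carried by subsets of \<^typ>\<open>complex\<close> (with arbitrary operations,
  so of any characteristic) are exactly the fields of cardinality at most the continuum. For
  countable groups this is no restriction: the entries of the matrices of a countable
  linear group lie in a countable subfield.\<close>

definition linear_group :: "'a monoid \<Rightarrow> bool" where
  "linear_group G \<longleftrightarrow>
    (\<exists>(F :: complex ring) m f. field F \<and> f \<in> mon G (GL F m))"

end

theory Submission
  imports Defs "HOL-Computational_Algebra.Formal_Power_Series" "HOL-Library.Z2"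
    "HOL-Algebra.Sylow" "HOL-Number_Theory.Cong"
begin

text \<open>
  Put \<open>W = C\<^sub>2 * C\<^sub>2 * C\<^sub>2\<close>. The three elements \<open>1 + t E\<close>, where \<open>E\<close> runs through the nilpotent matrices of
  rank one over \<open>F\<^sub>2\<close>, generate modulo \<open>t\<^sup>N\<close> a finite 2-group \<open>Q\<close> in which all cyclically reduced words of
  length between 2 and \<open>n\<close> have large order, because the coefficient of \<open>t\<^sup>l\<close> in a reduced word of length
  \<open>l\<close> is a product of consecutively distinct \<open>E\<close>'s and does not vanish.

  On the Cayley graph of \<open>Q\<close> consider integer cocycles \<open>\<tau>\<close>; they let \<open>W\<close> act on \<open>Q \<times> \<int>\<close>. A word \<open>w\<close> acts
  with finite order as soon as \<open>\<tau>\<close> sums to zero over each of the \<open>|Q| / ord w\<close> cycles of \<open>w\<close>. These are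
  fewer than \<open>2 |Q|\<close> linear conditions on \<open>3 |Q|\<close> unknowns, including antisymmetry; adding \<open>|Q|\<close>
  harmonicity conditions leaves a nonzero solution, and a nonzero harmonic cocycle is not a
  coboundary. Every other word is conjugate to a generator or to a shorter word, so the resulting virtually
  abelian group has a torsion \<open>n\<close>-ball and is infinite.

  The same count, with coefficients twisted by \<open>\<lambda>\<^bsup>k\<^esup>\<close> on the layer \<open>k\<close> of \<open>Q \<times> \<int>\<close>, yields a second cocycle with
  values in \<open>\<int>[\<lambda>, 1/\<lambda>]\<close>, hence an action on \<open>Q \<times> \<int> \<times> \<real>\<close> in which some element shifting the middle factor
  scales some translation by a power of \<open>\<lambda>\<close>. For the unit \<open>\<lambda> = 1 + sqrt 2\<close> the group is polycyclic but not virtually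
  nilpotent; for \<open>\<lambda> = 2\<close> it is not polycyclic.
\<close>

section \<open>Underdetermined linear systems\<close>

text \<open>Gaussian elimination without division: rows are cross-multiplied with a pivot, so
  coefficients and solution stay in the subring \<open>R\<close>, which need not be a field. This is
  what later yields cocycles with values in a prescribed ring.\<close>

lemma underdetermined_solution:
  fixes c :: "'i \<Rightarrow> 'j \<Rightarrow> real"
  assumes R: "0 \<in> R" "1 \<in> R" "\<And>a b. a \<in> R \<Longrightarrow> b \<in> R \<Longrightarrow> a - b \<in> R"
      "\<And>a b. a \<in> R \<Longrightarrow> b \<in> R \<Longrightarrow> a * b \<in> R"
    and "finite I" "finite J" "card I < card J"
    and "\<And>i j. i \<in> I \<Longrightarrow> j \<in> J \<Longrightarrow> c i j \<in> R"
  shows "\<exists>x. (\<forall>j\<in>J. x j \<in> R) \<and> (\<exists>j\<in>J. x j \<noteq> 0) \<and> (\<forall>i\<in>I. (\<Sum>j\<in>J. c i j * x j) = 0)"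
  using assms(5-)
proof (induction I arbitrary: J c rule: finite_induct)
  case empty
  then obtain j where "j \<in> J" by fastforce
  then show ?case using R(2) by (intro exI[of _ "\<lambda>_. 1"]) auto
next
  case (insert i I)
  show ?case
  proof (cases "\<forall>j\<in>J. c i j = 0")
    case True
    have "card I < card J" using insert by auto
    then obtain x where "(\<forall>j\<in>J. x j \<in> R) \<and> (\<exists>j\<in>J. x j \<noteq> 0) \<and> (\<forall>i\<in>I. (\<Sum>j\<in>J. c i j * x j) = 0)"
      using insert.IH[of J c] insert.prems by auto
    with True show ?thesis by (intro exI[of _ x]) auto
  next
    case False
    then obtain k where k: "k \<in> J" "c i k \<noteq> 0" by auto
    define J' where "J' = J - {k}"
    have J': "finite J'" "card I < card J'"
      using insert k by (auto simp: J'_def)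
    obtain x where x: "\<forall>j\<in>J'. x j \<in> R" "\<exists>j\<in>J'. x j \<noteq> 0"
      "\<forall>l\<in>I. (\<Sum>j\<in>J'. (c i k * c l j - c l k * c i j) * x j) = 0"
      using insert.IH[of J' "\<lambda>l j. c i k * c l j - c l k * c i j"] J' insert.prems k R
      by (auto simp: J'_def)
    \<comment> \<open>The entry at the pivot \<open>k\<close> is chosen to solve row
      \<open>i\<close>; all other entries are scaled by the pivot \<open>c i k\<close>, which
      replaces the usual division.\<close>
    define y where "y j = (if j = k then - (\<Sum>j\<in>J'. c i j * x j) else c i k * x j)" for j
    have neg: "- a \<in> R" if "a \<in> R" for a using R(3)[OF R(1) that] by simp
    then have add: "a + b \<in> R" if "a \<in> R" "b \<in> R" for a b
      using R(3)[OF that(1) neg[OF that(2)]] by simp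
    have sumR: "(\<Sum>j\<in>A. f j) \<in> R" if "\<And>j. j \<in> A \<Longrightarrow> f j \<in> R" "finite A" for A and f :: "'j \<Rightarrow> real"
      using that(2,1) by (induction) (auto intro: R(1) add)
    have split: "(\<Sum>j\<in>J. c l j * y j) = c i k * (\<Sum>j\<in>J'. c l j * x j) - c l k * (\<Sum>j\<in>J'. c i j * x j)" for l
    proof -
      have "(\<Sum>j\<in>J. c l j * y j) = c l k * y k + (\<Sum>j\<in>J'. c l j * y j)"
        unfolding J'_def using insert.prems k by (simp add: sum.remove)
      also have "(\<Sum>j\<in>J'. c l j * y j) = (\<Sum>j\<in>J'. c i k * (c l j * x j))"
        by (intro sum.cong) (auto simp: y_def J'_def)
      finally show ?thesis by (simp add: y_def sum_distrib_left)
    qed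
    have "(\<Sum>j\<in>J. c l j * y j) = 0" if "l \<in> insert i I" for l
    proof (cases "l = i")
      case False
      then have "(\<Sum>j\<in>J'. (c i k * c l j - c l k * c i j) * x j) = 0" using x that by auto
      then show ?thesis unfolding split
        by (simp add: left_diff_distrib sum_subtractf sum_distrib_left mult.assoc)
    qed (simp add: split)
    moreover have "y j \<in> R" if "j \<in> J" for j
    proof (cases "j = k")
      case True
      have "c i j * x j \<in> R" if "j \<in> J'" for j
        using that x(1) insert.prems(3)[of i j] R(4) by (simp add: J'_def)
      then show ?thesis using True J'(1) by (simp add: y_def neg sumR)
    next
      case False
      then have "x j \<in> R" "c i k \<in> R"
        using that x(1) insert.prems(3) k by (simp_all add: J'_def)
      then show ?thesis using False R(4) by (simp add: y_def)
    qed
    moreover have "\<exists>j\<in>J. y j \<noteq> 0"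
      using x(2) k by (auto simp: y_def J'_def)
    ultimately show ?thesis by blast
  qed
qed

lemma card_image_fibers:
  assumes "finite X" "\<And>x. x \<in> X \<Longrightarrow> m \<le> card {y \<in> X. f y = f x}"
  shows "m * card (f ` X) \<le> card X"
proof -
  have "m * card (f ` X) = (\<Sum>z\<in>f ` X. m)" by simp
  also have "\<dots> \<le> (\<Sum>z\<in>f ` X. card {y \<in> X. f y = z})"
    using assms(2) by (intro sum_mono) auto
  also have "\<dots> = card X"
    using sum.image_gen[OF assms(1), of "\<lambda>_. 1::nat" f] by simp
  finally show ?thesis .
qed

section \<open>Groups presented by words; a finite 2-group\<close>

text \<open>The kernel of \<open>\<Phi>\<close> is a congruence on words, and reversing a word
  inverts its class because letters square to the trivial class. A class is coded by the number of a
  chosen representative, which puts the carrier into \<open>nat\<close>.\<close>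

lemma word_monoid_ex:
  fixes \<Phi> :: "'l::countable list \<Rightarrow> 'b"
  assumes cong: "\<And>w w' v v'. \<Phi> w = \<Phi> w' \<Longrightarrow> \<Phi> v = \<Phi> v' \<Longrightarrow> \<Phi> (w @ v) = \<Phi> (w' @ v')"
    and invol: "\<And>s. \<Phi> [s, s] = \<Phi> []"
  shows "\<exists>(G :: nat monoid) p. group G \<and> carrier G = range p \<and>
    (\<forall>w v. p (w @ v) = p w \<otimes>\<^bsub>G\<^esub> p v) \<and> p [] = \<one>\<^bsub>G\<^esub> \<and> (\<forall>w v. p w = p v \<longleftrightarrow> \<Phi> w = \<Phi> v)"
proof -
  define p where "p w = to_nat (inv_into UNIV \<Phi> (\<Phi> w))" for w
  have p_eq: "p w = p v \<longleftrightarrow> \<Phi> w = \<Phi> v" for w v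
    by (metis p_def f_inv_into_f from_nat_to_nat rangeI)
  define G where "G = \<lparr>carrier = range p, monoid.mult = (\<lambda>a b. p (inv_into UNIV p a @ inv_into UNIV p b)), one = p []\<rparr>"
  have mult: "p w \<otimes>\<^bsub>G\<^esub> p v = p (w @ v)" for w v
  proof -
    have inv: "p (inv_into UNIV p (p w)) = p w" "p (inv_into UNIV p (p v)) = p v"
      by (rule f_inv_into_f, rule rangeI)+
    have "p (inv_into UNIV p (p w) @ inv_into UNIV p (p v)) = p (w @ v)"
      by (rule iffD2[OF p_eq, OF cong[OF iffD1[OF p_eq, OF inv(1)] iffD1[OF p_eq, OF inv(2)]]])
    then show ?thesis
      by (simp add: G_def)
  qed
  have one: "\<one>\<^bsub>G\<^esub> = p []" and carr: "carrier G = range p"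
    by (simp_all add: G_def)
  have rev: "p (rev w @ w) = p []" for w
  proof (induction w)
    case (Cons s w)
    have "\<Phi> (rev w @ [s, s] @ w) = \<Phi> (rev w @ [] @ w)"
      by (intro cong refl invol)
    then show ?case using Cons by (simp add: p_eq)
  qed simp
  have "group G"
  proof (rule groupI)
    fix x assume "x \<in> carrier G"
    then obtain w where "x = p w" by (auto simp: carr)
    then have "p (rev w) \<otimes>\<^bsub>G\<^esub> x = \<one>\<^bsub>G\<^esub>" by (simp add: mult rev one)
    then show "\<exists>y\<in>carrier G. y \<otimes>\<^bsub>G\<^esub> x = \<one>\<^bsub>G\<^esub>" by (auto simp: carr)
  qed (auto simp: carr mult one)
  then show ?thesis
    using p_eq mult one carr by metis
qed

section \<open>Matrices and power series over the field with two elements\<close>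

datatype mat2 = Mat2 bit bit bit bit

instantiation mat2 :: semiring_1
begin
definition "0 = Mat2 0 0 0 0"
definition "1 = Mat2 1 0 0 1"
fun plus_mat2 where "Mat2 a b c d + Mat2 a' b' c' d' = Mat2 (a + a') (b + b') (c + c') (d + d')"
fun times_mat2 where "Mat2 a b c d * Mat2 a' b' c' d' =
  Mat2 (a * a' + b * c') (a * b' + b * d') (c * a' + d * c') (c * b' + d * d')"
instance
proof
  fix a b c :: mat2
  show "a + b + c = a + (b + c)" by (cases a; cases b; cases c) (simp only: plus_mat2.simps add.assoc)
  show "a + b = b + a" by (cases a; cases b) (simp only: plus_mat2.simps mat2.inject add.commute simp_thms)
  show "0 + a = a" by (cases a) (simp add: zero_mat2_def)
  show "a * b * c = a * (b * c)" by (cases a; cases b; cases c) (simp only: times_mat2.simps mat2.inject ring_distribs ac_simps simp_thms)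
  show "0 * a = 0" "a * 0 = 0" "1 * a = a" "a * 1 = a"
    by (cases a, simp add: zero_mat2_def one_mat2_def)+
  show "(a + b) * c = a * c + b * c" "a * (b + c) = a * b + a * c"
    by (cases a; cases b; cases c, simp only: times_mat2.simps plus_mat2.simps mat2.inject ring_distribs ac_simps simp_thms)+
  show "(0::mat2) \<noteq> 1" by (simp add: zero_mat2_def one_mat2_def)
qed
end

lemma mat2_add_self [simp]: "a + a = (0::mat2)"
  by (cases a) (simp add: zero_mat2_def)

datatype letter = La | Lb | Lc

lemma UNIV_letter: "UNIV = {La, Lb, Lc}"
  using letter.exhaust by auto

instance letter :: finite
  by standard (simp add: UNIV_letter)

text \<open>Each of these matrices has its image equal to its kernel, a line; the three lines are
  distinct and are all the lines of the plane over the field with two elements.\<close>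

fun root_mat :: "letter \<Rightarrow> mat2" where
  "root_mat La = Mat2 0 1 0 0"
| "root_mat Lb = Mat2 0 0 1 0"
| "root_mat Lc = Mat2 1 1 1 1"

lemma root_mat_square: "root_mat s * root_mat s = 0"
  by (cases s) (simp_all add: zero_mat2_def)

lemma root_mat_neq_0: "root_mat s \<noteq> 0"
  by (cases s) (simp_all add: zero_mat2_def)

text \<open>The image of \<open>M\<close> is the line belonging to \<open>s\<close>, and the kernel
  of \<open>root_mat r\<close> is a different line.\<close>

lemma root_mat_mult_neq_0:
  assumes "root_mat s * M = 0" "M \<noteq> 0" "r \<noteq> s"
  shows "root_mat r * M \<noteq> 0"
  using assms by (cases M; cases r; cases s) (auto simp: zero_mat2_def)

definition gen_fps :: "letter \<Rightarrow> mat2 fps" where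
  "gen_fps s = 1 + fps_X * fps_const (root_mat s)"

definition word_fps :: "letter list \<Rightarrow> mat2 fps" where
  "word_fps w = prod_list (map gen_fps w)"

lemma gen_fps_mult_nth:
  "fps_nth (gen_fps s * f) i = fps_nth f i + (if i = 0 then 0 else root_mat s * fps_nth f (i - 1))"
  by (simp add: gen_fps_def algebra_simps mult.assoc)

lemma word_fps_Nil [simp]: "word_fps [] = 1"
  and word_fps_Cons [simp]: "word_fps (s # w) = gen_fps s * word_fps w"
  and word_fps_append: "word_fps (w @ v) = word_fps w * word_fps v"
  by (simp_all add: word_fps_def)

lemma word_fps_nth_0: "fps_nth (word_fps w) 0 = 1"
  by (induction w) (simp_all add: gen_fps_mult_nth del: fps_mult_nth_0)

text \<open>Characteristic two kills the linear term of the square, and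
  \<open>root_mat_square\<close> the quadratic one.\<close>

lemma word_fps_square: "word_fps [s, s] = 1"
  by (rule fps_ext) (auto simp: gen_fps_mult_nth gen_fps_def root_mat_square
      numeral_2_eq_2 less_Suc_eq algebra_simps mult.assoc fps_one_nth)

lemma word_fps_nth_eq_0: "i > length w \<Longrightarrow> fps_nth (word_fps w) i = 0"
  by (induction w arbitrary: i) (auto simp: gen_fps_mult_nth)

text \<open>The top coefficient is the product of the root matrices of the letters. Being
  annihilated by the root matrix of the first letter is the invariant that keeps the product nonzero
  when a different letter is put in front.\<close>

lemma word_fps_top:
  assumes "distinct_adj (s # w)"
  shows "fps_nth (word_fps (s # w)) (Suc (length w)) \<noteq> 0 \<and>
    root_mat s * fps_nth (word_fps (s # w)) (Suc (length w)) = 0"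
  using assms
proof (induction w arbitrary: s)
  case Nil
  then show ?case
    by (simp add: gen_fps_def root_mat_neq_0 root_mat_square)
next
  case (Cons r w)
  have "fps_nth (word_fps (s # r # w)) (Suc (Suc (length w))) =
      root_mat s * fps_nth (word_fps (r # w)) (Suc (length w))"
    by (subst word_fps_Cons, subst gen_fps_mult_nth) (simp add: word_fps_nth_eq_0 del: word_fps_Cons)
  moreover have "root_mat r * fps_nth (word_fps (r # w)) (Suc (length w)) = 0"
    "fps_nth (word_fps (r # w)) (Suc (length w)) \<noteq> 0" "s \<noteq> r"
    using Cons by auto
  ultimately show ?case
    using root_mat_mult_neq_0[of r _ s]
    by (simp add: mult.assoc[symmetric] root_mat_square del: word_fps_Cons)
qed

section \<open>Element orders and groups of 2-power exponent\<close>

lemma (in group) ord_eq_2I: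
  assumes "x \<in> carrier G" "x \<noteq> \<one>" "x \<otimes> x = \<one>"
  shows "ord x = 2"
proof -
  have "ord x dvd 2"
    using assms pow_eq_id[of x 2] by (simp add: numeral_2_eq_2)
  moreover have "ord x \<noteq> 1" using assms ord_eq_1 by simp
  ultimately show ?thesis using dvd_imp_le[of "ord x" 2] by (cases "ord x") (auto simp: le_Suc_eq)
qed

text \<open>Cauchy's theorem, obtained from Sylow's with exponent 1: every prime divisor of the
  group order is the order of an element and therefore divides \<open>2 ^ K\<close>.\<close>

lemma (in group) order_power_of_2:
  assumes fin: "finite (carrier G)" and exp: "\<And>g. g \<in> carrier G \<Longrightarrow> g [^] (2 ^ K :: nat) = \<one>"
  shows "\<exists>k. order G = 2 ^ k"
proof -
  have "order G > 0" using fin by (simp add: order_gt_0_iff_finite)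
  have two: "p = 2" if p: "prime p" "p dvd order G" for p
  proof -
    obtain m where m: "order G = p ^ 1 * m" using p(2) by auto
    obtain H where H: "subgroup H G" "card H = p"
      using sylow_thm[OF p(1) is_group m fin] by auto
    interpret H: group "G\<lparr>carrier := H\<rparr>"
      using H(1) by (rule subgroup_imp_group)
    have "card H > 1" using H(2) prime_gt_1_nat[OF p(1)] by simp
    then have "\<not> H \<subseteq> {\<one>}" using card_mono[of "{\<one>}" H] by auto
    then obtain h where h: "h \<in> H" "h \<noteq> \<one>" by auto
    then have hG: "h \<in> carrier G" using H(1) subgroup.mem_carrier by metis
    have "h [^] p = \<one>"
      using H.pow_order_eq_1[of h] h(1) H(2) by (simp add: order_def nat_pow_consistent[symmetric])
    then have "ord h dvd p"
      using hG pow_eq_id by blast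
    moreover have "ord h \<noteq> 1" using h(2) hG ord_eq_1 by auto
    ultimately have "ord h = p" using p(1) by (metis One_nat_def prime_nat_iff)
    moreover have "ord h dvd 2 ^ K" using exp[OF hG] hG pow_eq_id by blast
    ultimately show ?thesis using p(1) prime_dvd_power primes_dvd_imp_eq two_is_prime_nat by blast
  qed
  obtain m where km: "order G = 2 ^ multiplicity 2 (order G) * m" "\<not> 2 dvd m"
    using multiplicity_decompose'[of "order G" 2] \<open>order G > 0\<close> by auto
  then have "m = 1" using two prime_factor_nat[of m] by (metis dvd_mult)
  then show ?thesis using km(1) by (metis mult.right_neutral)
qed

section \<open>Polycyclic groups by coordinates\<close>

lemma int_subgroup_generator:
  fixes I :: "int set"
  assumes "0 \<in> I" and diff: "\<And>a b. a \<in> I \<Longrightarrow> b \<in> I \<Longrightarrow> a - b \<in> I"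
  obtains d where "d \<in> I" "\<And>a. a \<in> I \<Longrightarrow> d dvd a"
proof (cases "I = {0}")
  case True
  then show ?thesis using that[of 0] by auto
next
  case False
  have neg: "- a \<in> I" if "a \<in> I" for a using diff[OF assms(1) that] by simp
  have add: "a + b \<in> I" if "a \<in> I" "b \<in> I" for a b using diff[OF that(1) neg[OF that(2)]] by simp
  have mult_nat: "int n * a \<in> I" if "a \<in> I" for a n
    by (induction n) (auto simp: assms(1) that add distrib_right)
  have mult: "k * a \<in> I" if "a \<in> I" for a k
    using mult_nat[OF that, of "nat k"] neg[OF mult_nat[OF that, of "nat (- k)"]] by (cases "k \<ge> 0") auto
  obtain a where "a \<in> I" "a \<noteq> 0" using False assms(1) by auto
  then have ex: "\<exists>n>0. int n \<in> I"
    using neg[of a] by (intro exI[of _ "nat \<bar>a\<bar>"]) (simp add: abs_if)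
  define n where "n = (LEAST n. n > 0 \<and> int n \<in> I)"
  have n: "n > 0" "int n \<in> I" using LeastI_ex[OF ex] by (auto simp: n_def)
  have "int n dvd b" if "b \<in> I" for b
  proof (rule ccontr)
    assume "\<not> int n dvd b"
    then have "b mod int n > 0" "b mod int n < int n"
      using n(1) by (auto simp: dvd_eq_mod_eq_0 order_le_neq_trans)
    moreover have "b mod int n \<in> I"
      using diff[OF that mult[OF n(2), of "b div int n"]] by (simp add: minus_div_mult_eq_mod)
    ultimately have "n \<le> nat (b mod int n)"
      unfolding n_def by (intro Least_le) auto
    with \<open>b mod int n < int n\<close> show False using n(1) by linarith
  qed
  with n(2) that show ?thesis by blast
qed

text \<open>A homomorphism to the integers modulo \<open>m\<close>, represented by integers. The
  case \<open>m = 0\<close> is a homomorphism to \<open>\<int>\<close> itself, so that finite and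
  infinite cyclic factors are treated alike.\<close>

locale mod_hom = group +
  fixes \<theta> :: "'a \<Rightarrow> int" and m :: int
  assumes mod_hom: "g \<in> carrier G \<Longrightarrow> h \<in> carrier G \<Longrightarrow> m dvd \<theta> (g \<otimes> h) - \<theta> g - \<theta> h"
begin

definition "mod_kernel = {g \<in> carrier G. m dvd \<theta> g}"

lemma theta_mult: "g \<in> carrier G \<Longrightarrow> h \<in> carrier G \<Longrightarrow> [\<theta> (g \<otimes> h) = \<theta> g + \<theta> h] (mod m)"
  using mod_hom[of g h] by (simp add: cong_iff_dvd_diff algebra_simps)

lemma theta_one: "[\<theta> \<one> = 0] (mod m)"
  using mod_hom[of \<one> \<one>] by (simp add: cong_iff_dvd_diff)

lemma theta_inv: "g \<in> carrier G \<Longrightarrow> [\<theta> (inv g) = - \<theta> g] (mod m)"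
  using mod_hom[of g "inv g"] theta_one dvd_add[of m "\<theta> \<one> - \<theta> g - \<theta> (inv g)" "- \<theta> \<one>"]
    dvd_minus_iff[of m "- \<theta> g - \<theta> (inv g)"]
  by (simp add: cong_iff_dvd_diff algebra_simps)

lemma theta_int_pow:
  assumes "g \<in> carrier G"
  shows "[\<theta> (g [^] (n::int)) = n * \<theta> g] (mod m)"
proof (induction n rule: int_induct[where k = 0])
  case base
  then show ?case by (simp add: theta_one)
next
  case (step1 i)
  have "[\<theta> (g [^] (i + 1)) = \<theta> (g [^] i) + \<theta> g] (mod m)"
    using theta_mult[of "g [^] i" g] assms by (simp add: int_pow_mult)
  also have "[\<theta> (g [^] i) + \<theta> g = i * \<theta> g + \<theta> g] (mod m)"
    using step1 by (intro cong_add) auto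
  finally show ?case by (simp add: algebra_simps)
next
  case (step2 i)
  have "[\<theta> (g [^] (i - 1)) = \<theta> (g [^] i) + \<theta> (inv g)] (mod m)"
    using theta_mult[of "g [^] i" "inv g"] assms by (simp add: int_pow_diff)
  also have "[\<theta> (g [^] i) + \<theta> (inv g) = i * \<theta> g + - \<theta> g] (mod m)"
    using step2 theta_inv[OF assms] by (intro cong_add) auto
  finally show ?case by (simp add: algebra_simps)
qed

lemma mod_kernel_iff: "g \<in> mod_kernel \<longleftrightarrow> g \<in> carrier G \<and> [\<theta> g = 0] (mod m)"
  by (simp add: mod_kernel_def cong_0_iff)

lemma subgroup_mod_kernel: "subgroup mod_kernel G"
proof (rule subgroupI)
  show "mod_kernel \<subseteq> carrier G" by (auto simp: mod_kernel_iff)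
  show "mod_kernel \<noteq> {}" using theta_one mod_kernel_iff[of \<one>] by auto
next
  fix a assume "a \<in> mod_kernel"
  then show "inv a \<in> mod_kernel"
    using cong_trans[OF theta_inv, of a 0] cong_minus_minus_iff[of "\<theta> a" 0 m] by (auto simp: mod_kernel_iff)
next
  fix a b assume "a \<in> mod_kernel" "b \<in> mod_kernel"
  then show "a \<otimes> b \<in> mod_kernel"
    using cong_trans[OF theta_mult cong_add[of "\<theta> a" 0 m "\<theta> b" 0]] by (auto simp: mod_kernel_iff)
qed

lemma commutator_in_mod_kernel:
  assumes "a \<in> carrier G" "b \<in> carrier G"
  shows "a \<otimes> b \<otimes> inv a \<otimes> inv b \<in> mod_kernel"
proof -
  have "[\<theta> (a \<otimes> b \<otimes> inv a \<otimes> inv b) = \<theta> a + \<theta> b + - \<theta> a + - \<theta> b] (mod m)"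
    using assms
    by (intro cong_trans[OF theta_mult] cong_add cong_refl theta_inv) auto
  then show ?thesis using assms by (simp add: mod_kernel_iff)
qed

lemma normal_mod_kernel: "mod_kernel \<lhd> G"
proof (rule normal_invI[OF subgroup_mod_kernel])
  fix x h assume "x \<in> carrier G" "h \<in> mod_kernel"
  then have "x \<otimes> h \<otimes> inv x = (x \<otimes> h \<otimes> inv x \<otimes> inv h) \<otimes> h" "x \<otimes> h \<otimes> inv x \<otimes> inv h \<in> mod_kernel"
    using commutator_in_mod_kernel[of x h] by (auto simp: mod_kernel_def m_assoc)
  then show "x \<otimes> h \<otimes> inv x \<in> mod_kernel"
    using \<open>h \<in> mod_kernel\<close> subgroup.m_closed[OF subgroup_mod_kernel] by metis
qed

text \<open>The values of \<open>\<theta>\<close> together with the multiples of \<open>m\<close>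
  form a subgroup of \<open>\<int>\<close>; an element \<open>z\<close> whose value generates it up
  to a multiple of \<open>m\<close> also generates the quotient.\<close>

lemma cyclic_Mod_mod_kernel: "cyclic_group (G Mod mod_kernel)"
proof -
  interpret normal mod_kernel G by (rule normal_mod_kernel)
  define I where "I = {\<theta> g + m * j | g j. g \<in> carrier G}"
  have "0 \<in> I"
    using theta_one by (force simp: I_def cong_iff_dvd_diff dvd_def intro: exI[of _ "\<one>"] exI[of _ "- j" for j])
  moreover have "a - b \<in> I" if "a \<in> I" "b \<in> I" for a b
  proof -
    obtain g j where g: "g \<in> carrier G" "a = \<theta> g + m * j" using \<open>a \<in> I\<close> unfolding I_def by blast
    obtain h k where h: "h \<in> carrier G" "b = \<theta> h + m * k" using \<open>b \<in> I\<close> unfolding I_def by blast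
    note * = g h
    have "[\<theta> (g \<otimes> inv h) = \<theta> g + - \<theta> h] (mod m)"
      using * by (intro cong_trans[OF theta_mult] cong_add cong_refl theta_inv) auto
    then obtain l where "\<theta> g - \<theta> h = \<theta> (g \<otimes> inv h) + m * l"
      by (metis cong_iff_lin uminus_add_conv_diff add.commute)
    then have "a - b = \<theta> (g \<otimes> inv h) + m * (l + j - k)"
      using * by (simp add: algebra_simps)
    then show ?thesis using * unfolding I_def by blast
  qed
  ultimately obtain d where d: "d \<in> I" "\<And>a. a \<in> I \<Longrightarrow> d dvd a"
    using int_subgroup_generator[of I] by metis
  then obtain z j where z: "z \<in> carrier G" "d = \<theta> z + m * j" by (auto simp: I_def)
  have ex: "\<exists>n::int. mod_kernel #> g = mod_kernel #> (z [^] n)" if g: "g \<in> carrier G" for g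
  proof -
    have "\<theta> g + m * 0 \<in> I" using g unfolding I_def by blast
    then obtain n where n: "\<theta> g = d * n" using d(2) by (auto simp: dvd_def)
    have "[\<theta> (g \<otimes> inv (z [^] n)) = \<theta> g + - (n * \<theta> z)] (mod m)"
      using g z by (intro cong_trans[OF theta_mult] cong_add cong_refl cong_trans[OF theta_inv])
        (auto simp: cong_minus_minus_iff theta_int_pow)
    also have "\<theta> g + - (n * \<theta> z) = m * (j * n)" by (simp add: n z algebra_simps)
    finally have "g \<otimes> inv (z [^] n) \<in> mod_kernel"
      using g z by (simp add: mod_kernel_iff cong_def)
    moreover have "g = (g \<otimes> inv (z [^] n)) \<otimes> z [^] n" using g z by (simp add: m_assoc)
    ultimately have "g \<in> mod_kernel #> (z [^] n)" unfolding r_coset_def by blast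
    then show ?thesis using repr_independence[of g mod_kernel "z [^] n"] z subgroup_mod_kernel by auto
  qed
  interpret Q: group "G Mod mod_kernel" by (rule factorgroup_is_group)
  have hom: "(\<lambda>a. mod_kernel #> a) \<circ> (\<lambda>n::int. z [^] n) \<in> hom integer_group (G Mod mod_kernel)"
    using Group.hom_compose[OF hom_integer_group_pow[OF z(1)] r_coset_hom_Mod] .
  moreover have "((\<lambda>a. mod_kernel #> a) \<circ> (\<lambda>n::int. z [^] n)) ` carrier integer_group = carrier (G Mod mod_kernel)"
    using ex z(1) by (auto simp: FactGroup_def RCOSETS_def image_iff) 
  ultimately show ?thesis
    by (intro group.cyclic_group_epimorphic_image[OF group_integer_group _ cyclic_integer_group Q.is_group])
      (auto simp only: epi_def)
qed

end

lemma (in group) derived_subset: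
  assumes "subgroup L G" "\<And>a b. a \<in> H \<Longrightarrow> b \<in> H \<Longrightarrow> a \<otimes> b \<otimes> inv a \<otimes> inv b \<in> L"
  shows "derived G H \<subseteq> L"
  unfolding derived_def using assms by (intro generate_subgroup_incl) auto

text \<open>Coordinate \<open>k\<close> has to be additive only modulo \<open>m k\<close> and only
  where all earlier coordinates vanish. The common zero sets \<open>level k\<close> then form a
  descending chain of subgroups with cyclic factors.\<close>

locale coordinates = group G for G :: "'a monoid" (structure) +
  fixes \<phi> :: "nat \<Rightarrow> 'a \<Rightarrow> int" and m :: "nat \<Rightarrow> int" and K :: nat
  assumes coord_hom: "\<And>k g h. k < K \<Longrightarrow> g \<in> carrier G \<Longrightarrow> h \<in> carrier G \<Longrightarrow>
    (\<And>j. j < k \<Longrightarrow> m j dvd \<phi> j g) \<Longrightarrow> (\<And>j. j < k \<Longrightarrow> m j dvd \<phi> j h) \<Longrightarrow>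
    m k dvd \<phi> k (g \<otimes> h) - \<phi> k g - \<phi> k h"
begin

definition "level k = {g \<in> carrier G. \<forall>j<k. m j dvd \<phi> j g}"

lemma level_0: "level 0 = carrier G"
  and level_subset: "level k \<subseteq> carrier G"
  by (auto simp: level_def)

lemma mod_hom_level:
  assumes "subgroup (level k) G" "k < K"
  shows "mod_hom (G\<lparr>carrier := level k\<rparr>) (\<phi> k) (m k)"
proof -
  interpret H: group "G\<lparr>carrier := level k\<rparr>" using assms(1) by (rule subgroup_imp_group)
  show ?thesis
    using coord_hom[OF assms(2)] by unfold_locales (auto simp: level_def)
qed

lemma mod_kernel_level:
  assumes "subgroup (level k) G" "k < K"
  shows "mod_hom.mod_kernel (G\<lparr>carrier := level k\<rparr>) (\<phi> k) (m k) = level (Suc k)"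
  using mod_hom.mod_kernel_def[OF mod_hom_level[OF assms]] by (auto simp: level_def less_Suc_eq)

lemma subgroup_level: "k \<le> K \<Longrightarrow> subgroup (level k) G"
proof (induction k)
  case 0
  then show ?case by (simp add: level_0 subgroup_self)
next
  case (Suc k)
  then have "subgroup (level k) G" by simp
  moreover have "subgroup (level (Suc k)) (G\<lparr>carrier := level k\<rparr>)"
    using mod_hom.subgroup_mod_kernel[OF mod_hom_level] Suc mod_kernel_level by force
  ultimately show ?case using incl_subgroup by blast
qed

lemma commutator_level:
  assumes "k < K" "a \<in> level k" "b \<in> level k"
  shows "a \<otimes> b \<otimes> inv a \<otimes> inv b \<in> level (Suc k)"
  using mod_hom.commutator_in_mod_kernel[OF mod_hom_level, of k a b] assms subgroup_level[of k]
  by (simp add: mod_kernel_level m_inv_consistent)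

lemma exp_derived_level: "k \<le> K \<Longrightarrow> (derived G ^^ k) (carrier G) \<subseteq> level k"
proof (induction k)
  case (Suc k)
  have "derived G ((derived G ^^ k) (carrier G)) \<subseteq> level (Suc k)"
    using Suc commutator_level[of k] subgroup_level[of "Suc k"] by (intro derived_subset) auto
  then show ?case by simp
qed (simp add: level_0)

text \<open>Each derivation kills one more coordinate, so after \<open>K\<close> of them the derived
  series has entered the last level; since elements commute there, one more step ends it.\<close>

lemma solvable_if_level_comm:
  assumes "\<And>a b. a \<in> level K \<Longrightarrow> b \<in> level K \<Longrightarrow> a \<otimes> b = b \<otimes> a"
  shows "solvable G"
proof -
  have "a \<otimes> b \<otimes> inv a \<otimes> inv b = \<one>" if "a \<in> level K" "b \<in> level K" for a b
    using assms[OF that] that by (simp add: level_def m_assoc)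
  then have "derived G ((derived G ^^ K) (carrier G)) \<subseteq> {\<one>}"
    using exp_derived_level[of K] by (intro derived_subset triv_subgroup) auto
  then have "(derived G ^^ Suc K) (carrier G) = {\<one>}"
    using subgroup.one_closed[OF exp_of_derived_is_subgroup[OF subgroup_self, of "Suc K"]] by auto
  then show ?thesis
    unfolding solvable_def by (rule trivial_derived_seq_imp_solvable[OF subgroup_self])
qed

lemma polycyclic_if_level_trivial:
  assumes "level K = {\<one>}"
  shows "polycyclic G"
  unfolding polycyclic_def
proof (intro exI conjI allI impI)
  \<comment> \<open>Levels descend whereas the series in \<open>polycyclic\<close> ascends, hence
    the index \<open>K - i\<close>.\<close>
  show "level (K - 0) = {\<one>}" "level (K - K) = carrier G"
    by (simp_all add: assms level_0)
  show "subgroup (level (K - i)) G" for i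
    by (simp add: subgroup_level)
next
  fix i assume i: "i < K"
  define k where "k = K - Suc i"
  have k: "K - i = Suc k" "k < K" using i by (auto simp: k_def)
  have sub: "subgroup (level k) G" using k(2) by (simp add: subgroup_level)
  note * = mod_hom_level[OF sub k(2)] mod_kernel_level[OF sub k(2)]
  show "level (K - i) \<lhd> G\<lparr>carrier := level (K - Suc i)\<rparr>"
    "cyclic_group (G\<lparr>carrier := level (K - Suc i)\<rparr> Mod level (K - i))"
    using mod_hom.normal_mod_kernel[OF *(1)] mod_hom.cyclic_Mod_mod_kernel[OF *(1)] k
    by (simp_all add: * k_def[symmetric])
qed

text \<open>Squaring an element of \<open>level k\<close> doubles its next coordinate modulo 2 and
  so moves it into \<open>level (Suc k)\<close>.\<close>

lemma exponent_2_power: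
  assumes m: "\<And>k. k < K \<Longrightarrow> m k = 2" and triv: "level K = {\<one>}" and g: "g \<in> carrier G"
  shows "g [^] (2 ^ K :: nat) = \<one>"
proof -
  have "k \<le> K \<Longrightarrow> g [^] (2 ^ k :: nat) \<in> level k" for k
  proof (induction k)
    case 0
    then show ?case using g by (simp add: level_0)
  next
    case (Suc k)
    define h where "h = g [^] (2 ^ k :: nat)"
    have h: "h \<in> level k" "h \<in> carrier G" using Suc level_subset by (auto simp: h_def)
    have "h \<otimes> h \<in> level k" using h(1) Suc.prems subgroup.m_closed[OF subgroup_level] by auto
    moreover have "2 dvd \<phi> k (h \<otimes> h)"
      using coord_hom[of k h h] h m[of k] Suc.prems by (auto simp: level_def)
    moreover have "h \<otimes> h = g [^] (2 ^ Suc k :: nat)"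
      using g by (simp add: h_def nat_pow_mult mult_2)
    ultimately show ?case using m[of k] Suc.prems by (auto simp: level_def less_Suc_eq)
  qed
  then show ?thesis using triv by auto
qed

end


section \<open>The finite 2-group in which short reduced words survive\<close>

instance mat2 :: finite
proof
  have "(UNIV :: bit set) \<subseteq> {0, 1}"
    by (metis bit.exhaust insertCI subsetI)
  then have bit: "finite (UNIV :: bit set)" by (rule finite_subset) simp
  have "M \<in> range (\<lambda>(a, b, c, d). Mat2 a b c d)" for M
    by (cases M) (metis (mono_tags, lifting) case_prod_conv rangeI)
  then have "UNIV = (\<lambda>(a, b, c, d). Mat2 a b c d) ` (UNIV \<times> UNIV \<times> UNIV \<times> UNIV)" by auto
  then show "finite (UNIV :: mat2 set)" using bit by (metis finite_SigmaI finite_imageI)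
qed

fun mat2_entry :: "nat \<Rightarrow> mat2 \<Rightarrow> bit" where
  "mat2_entry i (Mat2 a b c d) = (if i = 0 then a else if i = 1 then b else if i = 2 then c else d)"

lemma mat2_entry_add: "mat2_entry i (M + M') = mat2_entry i M + mat2_entry i M'"
  by (cases M; cases M') simp

lemma mat2_eq_0_iff: "M = 0 \<longleftrightarrow> (\<forall>i<4. mat2_entry i M = 0)"
  by (cases M) (auto simp: zero_mat2_def numeral_eq_Suc less_Suc_eq)

text \<open>Words are identified when their series agree in degrees below \<open>N\<close>. This
  leaves finitely many classes, and \<open>word_fps_top\<close> separates short reduced words from
  the empty one. The matrix entries of the coefficients, ordered by degree, are coordinates modulo
  2.\<close>

theorem two_group_ex:
  fixes N :: nat
  assumes "N > 0"
  obtains Q :: "nat monoid" and p :: "letter list \<Rightarrow> nat" and \<theta> :: "nat \<Rightarrow> nat \<Rightarrow> int" and K k :: nat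
  where "group Q" "carrier Q = range p" "\<And>w v. p (w @ v) = p w \<otimes>\<^bsub>Q\<^esub> p v" "p [] = \<one>\<^bsub>Q\<^esub>"
    "\<And>s. p [s, s] = \<one>\<^bsub>Q\<^esub>" "finite (carrier Q)" "order Q = 2 ^ k"
    "\<And>w. distinct_adj w \<Longrightarrow> w \<noteq> [] \<Longrightarrow> length w < N \<Longrightarrow> p w \<noteq> \<one>\<^bsub>Q\<^esub>"
    "coordinates Q \<theta> (\<lambda>_. 2) K"
    "coordinates.level Q \<theta> (\<lambda>_. 2) K = {\<one>\<^bsub>Q\<^esub>}"
proof -
  define \<Phi> where "\<Phi> w = (\<lambda>i. if i < N then fps_nth (word_fps w) i else 0)" for w
  have \<Phi>_eq: "\<Phi> w = \<Phi> v \<longleftrightarrow> (\<forall>i<N. fps_nth (word_fps w) i = fps_nth (word_fps v) i)" for w v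
    by (auto simp: \<Phi>_def fun_eq_iff)
  have cong: "\<Phi> (w @ v) = \<Phi> (w' @ v')" if "\<Phi> w = \<Phi> w'" "\<Phi> v = \<Phi> v'" for w w' v v'
    using that unfolding \<Phi>_eq word_fps_append fps_mult_nth by (auto intro!: sum.cong)
  have invol: "\<Phi> [s, s] = \<Phi> []" for s
    unfolding \<Phi>_def word_fps_square word_fps_Nil ..
  obtain Q :: "nat monoid" and p where Q: "group Q" "carrier Q = range p" "\<And>w v. p (w @ v) = p w \<otimes>\<^bsub>Q\<^esub> p v" "p [] = \<one>\<^bsub>Q\<^esub>"
    and p_eq: "\<And>w v. p w = p v \<longleftrightarrow> \<Phi> w = \<Phi> v"
    using word_monoid_ex[of \<Phi>] cong invol by blast
  interpret Q: group Q by fact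
  define c where "c g = \<Phi> (SOME w. p w = g)" for g
  have c: "c (p w) = \<Phi> w" for w
    unfolding c_def using someI[of "\<lambda>v. p v = p w" w] p_eq by auto
  have inj: "inj_on c (carrier Q)"
    by (auto simp: inj_on_def Q(2) c p_eq)
  have c_one: "c \<one>\<^bsub>Q\<^esub> = \<Phi> []" using c[of "[]"] Q(4) by simp
  have "finite (range \<Phi>)"
    by (rule finite_subset[OF _ finite_set_of_finite_funs[of "{..<N}" UNIV 0]]) (auto simp: \<Phi>_def)
  moreover have "c ` carrier Q \<subseteq> range \<Phi>" using c by (auto simp: Q(2))
  ultimately have fin: "finite (carrier Q)"
    using inj finite_imageD finite_subset by blast
  \<comment> \<open>Each degree contributes four coordinates, lifted from \<open>bit\<close> to 0 or
    1. The count starts in degree 1, because the coefficient in degree 0 is always the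
    identity.\<close>
  define \<theta> where "\<theta> k g = (if mat2_entry (k mod 4) (c g (k div 4 + 1)) = 0 then 0 else 1 :: int)" for k g
  have \<theta>: "2 dvd \<theta> k g \<longleftrightarrow> mat2_entry (k mod 4) (c g (k div 4 + 1)) = 0" for k g
    by (simp add: \<theta>_def)
  define K where "K = 4 * (N - 1)"
  have vanish: "c g i = 0" if "\<forall>j<4 * i'. 2 dvd \<theta> j g" "0 < i" "i \<le> i'" for g i i'
    unfolding mat2_eq_0_iff
  proof (intro allI impI)
    fix e :: nat assume "e < 4"
    then have "4 * (i - 1) + e < 4 * i'" "(4 * (i - 1) + e) mod 4 = e" "(4 * (i - 1) + e) div 4 = i - 1"
      using that by auto
    with that(1) show "mat2_entry e (c g i) = 0"
      using that(2) unfolding \<theta> by fastforce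
  qed
  have coord: "coordinates Q \<theta> (\<lambda>_. 2) K"
  proof
    fix k g h
    assume k: "k < K" and g: "g \<in> carrier Q" and h: "h \<in> carrier Q"
      and *: "\<And>j. j < k \<Longrightarrow> 2 dvd \<theta> j g" "\<And>j. j < k \<Longrightarrow> 2 dvd \<theta> j h"
    obtain w v where wv: "g = p w" "h = p v" using g h by (auto simp: Q(2))
    define i where "i = k div 4"
    have i: "Suc i < N" using k by (auto simp: i_def K_def)
    have low: "fps_nth (word_fps w) j = 0" if "0 < j" "j \<le> i" for j
      using vanish[of i g j] c[of w] *(1) that i wv by (auto simp: i_def \<Phi>_def fun_eq_iff split: if_splits)
    \<comment> \<open>Since the coefficients of \<open>w\<close> in degrees 1 to \<open>i\<close>
      vanish, only the two outer terms of the Cauchy product remain, and the first relevant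
      coefficient is additive.\<close>
    have "fps_nth (word_fps (w @ v)) (Suc i) = (\<Sum>j=0..Suc i. fps_nth (word_fps w) j * fps_nth (word_fps v) (Suc i - j))"
      by (simp add: word_fps_append fps_mult_nth)
    also have "\<dots> = (\<Sum>j\<in>{0, Suc i}. fps_nth (word_fps w) j * fps_nth (word_fps v) (Suc i - j))"
      using low by (intro sum.mono_neutral_right) auto
    also have "\<dots> = fps_nth (word_fps w) (Suc i) + fps_nth (word_fps v) (Suc i)"
      by (simp add: word_fps_nth_0 add.commute)
    finally have "c (g \<otimes>\<^bsub>Q\<^esub> h) (Suc i) = c g (Suc i) + c h (Suc i)"
      using i by (simp add: wv Q(3)[symmetric] c \<Phi>_def)
    then have "mat2_entry (k mod 4) (c (g \<otimes>\<^bsub>Q\<^esub> h) (k div 4 + 1)) =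
        mat2_entry (k mod 4) (c g (k div 4 + 1)) + mat2_entry (k mod 4) (c h (k div 4 + 1))"
      by (simp add: i_def mat2_entry_add)
    then show "2 dvd \<theta> k (g \<otimes>\<^bsub>Q\<^esub> h) - \<theta> k g - \<theta> k h"
      unfolding \<theta>_def by auto
  qed
  then interpret coordinates Q \<theta> "\<lambda>_. 2" K .
  have "g = \<one>\<^bsub>Q\<^esub>" if "g \<in> level K" for g
  proof -
    obtain w where w: "g = p w" using \<open>g \<in> level K\<close> level_subset Q(2) by blast
    have "fps_nth (word_fps w) i = fps_nth (word_fps []) i" if "i < N" for i
    proof (cases "i = 0")
      case False
      then have "c g i = 0"
        using \<open>g \<in> level K\<close> that by (intro vanish[of "N - 1"]) (auto simp: level_def K_def)
      then show ?thesis using False that by (simp add: w c \<Phi>_def)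
    qed (simp add: word_fps_nth_0 del: word_fps_Nil)
    then show ?thesis unfolding w Q(4)[symmetric] p_eq \<Phi>_eq by blast
  qed
  moreover have "\<one>\<^bsub>Q\<^esub> \<in> level K"
    using subgroup.one_closed[OF subgroup_level] by blast
  ultimately have triv: "level K = {\<one>\<^bsub>Q\<^esub>}" by blast
  obtain k where k: "order Q = 2 ^ k"
    using Q.order_power_of_2[OF fin] exponent_2_power[OF _ triv] by blast
  show thesis
  proof (rule that[OF Q _ fin k _ coord triv])
    show "p [s, s] = \<one>\<^bsub>Q\<^esub>" for s
      unfolding Q(4)[symmetric] p_eq \<Phi>_def word_fps_square word_fps_Nil ..
  next
    fix w :: "letter list" assume w: "distinct_adj w" "w \<noteq> []" "length w < N"
    show "p w \<noteq> \<one>\<^bsub>Q\<^esub>"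
    proof
      assume "p w = \<one>\<^bsub>Q\<^esub>"
      then have "fps_nth (word_fps w) (length w) = fps_nth (word_fps []) (length w)"
        using w(3) unfolding Q(4)[symmetric] p_eq \<Phi>_eq by blast
      then show False using w word_fps_top[of "hd w" "tl w"] by (cases w) auto
    qed
  qed
qed

section \<open>Twisted actions\<close>

lemma (in group) cyclic_factor_generator:
  assumes "N \<lhd> G" "cyclic_group (G Mod N)"
  obtains M :: "'a set monoid" and f :: "'a \<Rightarrow> 'a set" and X where "group_hom G M f" "X \<in> carrier M"
    "\<And>h. h \<in> carrier G \<Longrightarrow> \<exists>n::int. f h = X [^]\<^bsub>M\<^esub> n"
    "\<And>h. h \<in> carrier G \<Longrightarrow> f h = \<one>\<^bsub>M\<^esub> \<Longrightarrow> h \<in> N"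
proof -
  interpret normal N G by fact
  interpret M: group "G Mod N" by (rule factorgroup_is_group)
  have f: "group_hom G (G Mod N) (\<lambda>a. N #> a)"
    by (intro group_hom.intro group_hom_axioms.intro r_coset_hom_Mod) unfold_locales
  obtain X where X: "X \<in> carrier (G Mod N)" "carrier (G Mod N) = range (\<lambda>n::int. X [^]\<^bsub>G Mod N\<^esub> n)"
    using assms(2) M.cyclic_group by auto
  show thesis
  proof (rule that[OF f X(1)])
    fix h assume h: "h \<in> carrier G"
    then have "N #> h \<in> carrier (G Mod N)" by (auto simp: FactGroup_def RCOSETS_def)
    then show "\<exists>n::int. N #> h = X [^]\<^bsub>G Mod N\<^esub> n" using X(2) by auto
    assume "N #> h = \<one>\<^bsub>G Mod N\<^esub>"
    then show "h \<in> N" using h rcos_self[OF h is_subgroup] by (simp add: FactGroup_def)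
  qed
qed

text \<open>The exponents reached in the cyclic factor by the union of the chain form a subgroup of
  \<open>\<int>\<close>, whose generator is attained at a single stage by some \<open>z\<close>.
  From then on every element of the chain differs by a power of \<open>z\<close> from an element of
  \<open>N\<close>, where the chain is already constant.\<close>

lemma (in group) ascending_chain_extension:
  fixes C :: "nat \<Rightarrow> 'a set"
  assumes N: "N \<lhd> G" "cyclic_group (G Mod N)"
    and C: "\<And>j. subgroup (C j) G" "\<And>i j. i \<le> j \<Longrightarrow> C i \<subseteq> C j"
    and stable: "\<And>j. j \<ge> j0 \<Longrightarrow> C j \<inter> N = C j0 \<inter> N"
  shows "\<exists>j1. \<forall>j\<ge>j1. C j = C j1"
proof -
  obtain M :: "'a set monoid" and f X where f: "group_hom G M f" and X: "X \<in> carrier M"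
    and ex: "\<And>h. h \<in> carrier G \<Longrightarrow> \<exists>n::int. f h = X [^]\<^bsub>M\<^esub> n"
    and ker: "\<And>h. h \<in> carrier G \<Longrightarrow> f h = \<one>\<^bsub>M\<^esub> \<Longrightarrow> h \<in> N"
    by (rule cyclic_factor_generator[OF N]) blast
  interpret f: group_hom G M f by fact
  define I where "I = {n::int. \<exists>j. \<exists>c\<in>C j. f c = X [^]\<^bsub>M\<^esub> n}"
  have sub: "c \<in> carrier G" if "c \<in> C j" for c j using subgroup.mem_carrier[OF C(1) that] .
  have "0 \<in> I"
    unfolding I_def using subgroup.one_closed[OF C(1)] by (auto intro!: exI[of _ 0] bexI[of _ \<one>])
  moreover have "a - b \<in> I" if ab: "a \<in> I" "b \<in> I" for a b
  proof -
    obtain i j c d where *: "c \<in> C i" "d \<in> C j" "f c = X [^]\<^bsub>M\<^esub> a" "f d = X [^]\<^bsub>M\<^esub> b"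
      using ab by (auto simp: I_def)
    then have "c \<in> C (max i j)" "d \<in> C (max i j)"
      using subsetD[OF C(2)[of i "max i j"]] subsetD[OF C(2)[of j "max i j"]] by simp_all
    then have "c \<otimes> inv d \<in> C (max i j)" using C(1) by (meson subgroup.m_closed subgroup.m_inv_closed)
    moreover have "f (c \<otimes> inv d) = X [^]\<^bsub>M\<^esub> (a - b)"
      using * sub X by (simp add: f.H.int_pow_diff)
    ultimately show ?thesis unfolding I_def by blast
  qed
  ultimately obtain d where d: "d \<in> I" "\<And>a. a \<in> I \<Longrightarrow> d dvd a"
    using int_subgroup_generator[of I] by metis
  then obtain j1 z where z: "z \<in> C j1" "f z = X [^]\<^bsub>M\<^esub> d" by (auto simp: I_def)
  define j2 where "j2 = max j0 j1"
  have "C j \<subseteq> C j2" if j: "j \<ge> j2" for j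
  proof
    fix c assume c: "c \<in> C j"
    then obtain n :: int where n: "f c = X [^]\<^bsub>M\<^esub> n" using ex[OF sub[OF c]] by blast
    then have "n \<in> I" unfolding I_def using c by auto
    then obtain q where q: "n = d * q" using d(2) by (auto simp: dvd_def)
    have z2: "z \<in> C j2" and zj: "z \<in> C j"
      using subsetD[OF C(2)[of j1 j2]] subsetD[OF C(2)[of j1 j]] z(1) j by (simp_all add: j2_def)
    define y where "y = z [^] q"
    have y: "y \<in> C j2" "y \<in> C j" using z2 zj subgroup_int_pow_closed[OF C(1)] by (auto simp: y_def)
    have cG: "c \<in> carrier G" "y \<in> carrier G" "z \<in> carrier G" using c y z sub by auto
    have "f (c \<otimes> inv y) = \<one>\<^bsub>M\<^esub>"
      using cG X by (simp add: y_def f.hom_int_pow z n q f.H.int_pow_pow)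
    then have "c \<otimes> inv y \<in> N" using ker cG by simp
    moreover have "c \<otimes> inv y \<in> C j" using c y C(1) by (meson subgroup.m_closed subgroup.m_inv_closed)
    ultimately have "c \<otimes> inv y \<in> C j0" using stable[of j] j by (auto simp: j2_def)
    then have "c \<otimes> inv y \<in> C j2" using C(2)[of j0 j2] by (auto simp: j2_def)
    then have "(c \<otimes> inv y) \<otimes> y \<in> C j2" using y C(1) by (meson subgroup.m_closed)
    then show "c \<in> C j2" using cG by (simp add: m_assoc)
  qed
  then show ?thesis using C(2) by blast
qed

text \<open>Induction along the cyclic series: the traces of the chain on \<open>H i\<close> become
  constant for each \<open>i\<close> in turn.\<close>

theorem polycyclic_ascending_chain:
  fixes G (structure) and C :: "nat \<Rightarrow> 'a set"
  assumes "group G" "polycyclic G"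
    and C: "\<And>j. subgroup (C j) G" "\<And>i j. i \<le> j \<Longrightarrow> C i \<subseteq> C j"
  shows "\<exists>j0. \<forall>j\<ge>j0. C j = C j0"
proof -
  interpret group G by fact
  obtain k H where H: "H 0 = {\<one>}" "H k = carrier G" "\<And>i. i \<le> k \<Longrightarrow> subgroup (H i) G"
    "\<And>i. i < k \<Longrightarrow> H i \<lhd> G\<lparr>carrier := H (Suc i)\<rparr>"
    "\<And>i. i < k \<Longrightarrow> cyclic_group (G\<lparr>carrier := H (Suc i)\<rparr> Mod H i)"
    using assms(2) unfolding polycyclic_def by blast
  have "\<exists>j0. \<forall>j\<ge>j0. C j \<inter> H i = C j0 \<inter> H i" if "i \<le> k" for i
    using that
  proof (induction i)
    case 0
    have "C j \<inter> H 0 = {\<one>}" for j using subgroup.one_closed[OF C(1)] H(1) by auto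
    then show ?case by auto
  next
    case (Suc i)
    then obtain j0 where j0: "\<forall>j\<ge>j0. C j \<inter> H i = C j0 \<inter> H i" by auto
    have sub: "subgroup (H (Suc i)) G" using H(3) Suc by simp
    interpret L: group "G\<lparr>carrier := H (Suc i)\<rparr>" using sub by (rule subgroup_imp_group)
    have le: "H i \<subseteq> H (Suc i)"
      using H(4)[of i] Suc.prems normal_imp_subgroup subgroup.subset by fastforce
    have "\<exists>j1. \<forall>j\<ge>j1. C j \<inter> H (Suc i) = C j1 \<inter> H (Suc i)"
    proof (rule L.ascending_chain_extension[where C = "\<lambda>j. C j \<inter> H (Suc i)" and N = "H i"])
      show "subgroup (C j \<inter> H (Suc i)) (G\<lparr>carrier := H (Suc i)\<rparr>)" for j
        using subgroups_Inter_pair[OF C(1) sub] by (intro subgroup_incl sub) auto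
      show "C j \<inter> H (Suc i) \<inter> H i = C j0 \<inter> H (Suc i) \<inter> H i" if "j \<ge> j0" for j
        using le j0 that by blast
    qed (use Suc C(2) H(4,5) in auto)
    then show ?case .
  qed
  then obtain j0 where "\<forall>j\<ge>j0. C j \<inter> H k = C j0 \<inter> H k" by blast
  moreover have "C j \<inter> H k = C j" for j using H(2) subgroup.subset[OF C(1)] by auto
  ultimately show ?thesis by auto
qed

text \<open>Pigeonhole: two different powers of \<open>g\<close> lie in the same coset of
  \<open>H\<close>.\<close>

lemma (in group) finite_index_power:
  assumes H: "subgroup H G" "finite (rcosets H)" and g: "g \<in> carrier G"
  obtains n :: nat where "n > 0" "g [^] n \<in> H"
proof -
  have "range (\<lambda>n::nat. H #> g [^] n) \<subseteq> rcosets H"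
    using g by (auto simp: RCOSETS_def)
  then have "\<not> inj (\<lambda>n::nat. H #> g [^] n)"
    using H(2) finite_subset range_inj_infinite by blast
  then obtain a b where ab: "a < b" "H #> g [^] a = H #> g [^] (b :: nat)"
    by (metis (no_types, lifting) injI linorder_neqE_nat)
  have "g [^] b \<in> H #> g [^] a" using rcos_self[OF _ H(1), of "g [^] b"] ab g by simp
  then obtain h where h: "h \<in> H" "g [^] b = h \<otimes> g [^] a" by (auto simp: r_coset_def)
  have "g [^] b = g [^] (b - a) \<otimes> g [^] a" using g ab by (simp add: nat_pow_mult)
  then have "g [^] (b - a) = h"
    using h g subgroup.mem_carrier[OF H(1)] by (metis nat_pow_closed right_cancel)
  then show thesis using that[of "b - a"] h ab by simp
qed

lemma powi_neq_1:
  fixes a :: real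
  assumes "a > 0" "a \<noteq> 1" "i \<noteq> 0"
  shows "a powi i \<noteq> 1"
proof
  assume "a powi i = 1"
  then have "a powr of_int i = 1" using assms(1) by (simp add: powr_real_of_int')
  then have "of_int i * ln a = 0" using ln_powr[of a "of_int i"] assms(1) by simp
  then show False using assms by simp
qed

text \<open>An element \<open>g\<close> acts on \<open>Q \<times> \<int> \<times> \<real>\<close> by
  \<open>(x, k, v) \<mapsto> (U g \<otimes> x, k + T g x, v + lam\<^bsup>k\<^esup> * B g x)\<close>.\<close>

locale twisted_action = group G + Q: group Q
  for G :: "'g monoid" (structure) and Q :: "'q monoid" +
  fixes U :: "'g \<Rightarrow> 'q" and T :: "'g \<Rightarrow> 'q \<Rightarrow> int" and B :: "'g \<Rightarrow> 'q \<Rightarrow> real" and lam :: real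
  assumes finite_Q: "finite (carrier Q)"
    and U_hom: "U \<in> hom G Q" and U_surj: "U ` carrier G = carrier Q"
    and T_mult: "\<And>g h x. g \<in> carrier G \<Longrightarrow> h \<in> carrier G \<Longrightarrow> x \<in> carrier Q \<Longrightarrow>
      T (g \<otimes> h) x = T h x + T g (U h \<otimes>\<^bsub>Q\<^esub> x)"
    and B_mult: "\<And>g h x. g \<in> carrier G \<Longrightarrow> h \<in> carrier G \<Longrightarrow> x \<in> carrier Q \<Longrightarrow>
      B (g \<otimes> h) x = B h x + lam powi T h x * B g (U h \<otimes>\<^bsub>Q\<^esub> x)"
    and faithful: "\<And>g. g \<in> carrier G \<Longrightarrow> U g = \<one>\<^bsub>Q\<^esub> \<Longrightarrow>
      (\<And>x. x \<in> carrier Q \<Longrightarrow> T g x = 0) \<Longrightarrow> (\<And>x. x \<in> carrier Q \<Longrightarrow> B g x = 0) \<Longrightarrow> g = \<one>"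
    and lam_pos: "lam > 0"
begin

sublocale U: group_hom G Q U
  by unfold_locales (rule U_hom)

text \<open>Elements of \<open>ker_U\<close> preserve each fibre over a point of \<open>Q\<close>;
  those of \<open>ker_UT\<close> also preserve the layers and move only the real coordinate. The
  latter form the abelian bottom of the group.\<close>

definition "ker_U = {g \<in> carrier G. U g = \<one>\<^bsub>Q\<^esub>}"
definition "ker_UT = {g \<in> ker_U. \<forall>x\<in>carrier Q. T g x = 0}"

lemma ker_U_kernel: "ker_U = kernel G Q U"
  by (auto simp: ker_U_def kernel_def)

lemma normal_ker_U: "ker_U \<lhd> G"
  unfolding ker_U_kernel by (rule U.normal_kernel)

lemma subgroup_ker_U: "subgroup ker_U G"
  using normal_ker_U by (rule normal_imp_subgroup)

lemma T_one: "x \<in> carrier Q \<Longrightarrow> T \<one> x = 0"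
  using T_mult[of \<one> \<one> x] by simp

lemma B_one: "x \<in> carrier Q \<Longrightarrow> B \<one> x = 0"
  using B_mult[of \<one> \<one> x] by (simp add: T_one)

lemma T_ker_U: "g \<in> ker_U \<Longrightarrow> h \<in> ker_U \<Longrightarrow> x \<in> carrier Q \<Longrightarrow> T (g \<otimes> h) x = T g x + T h x"
  using T_mult[of g h x] by (auto simp: ker_U_def)

lemma T_ker_U_inv: "g \<in> ker_U \<Longrightarrow> x \<in> carrier Q \<Longrightarrow> T (inv g) x = - T g x"
  using T_ker_U[of "inv g" g x] subgroup.m_inv_closed[OF subgroup_ker_U, of g] T_one[of x]
  by (auto simp: ker_U_def)

lemma T_ker_U_pow: "g \<in> ker_U \<Longrightarrow> x \<in> carrier Q \<Longrightarrow> T (g [^] (n::nat)) x = int n * T g x"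
proof (induction n)
  case (Suc n)
  have "g [^] n \<in> ker_U" using Suc.prems(1) by (auto simp: ker_U_def U.hom_nat_pow)
  then show ?case using Suc T_ker_U[of "g [^] n" g x] by (simp add: algebra_simps)
qed (simp add: T_one)

lemma subgroup_ker_UT: "subgroup ker_UT G"
proof (rule subgroupI)
  show "ker_UT \<subseteq> carrier G" by (auto simp: ker_UT_def ker_U_def)
  show "ker_UT \<noteq> {}" using T_one subgroup.one_closed[OF subgroup_ker_U] unfolding ker_UT_def by blast
  show "inv a \<in> ker_UT" if "a \<in> ker_UT" for a
    using that subgroup.m_inv_closed[OF subgroup_ker_U] by (auto simp: ker_UT_def T_ker_U_inv)
  show "a \<otimes> b \<in> ker_UT" if "a \<in> ker_UT" "b \<in> ker_UT" for a b
    using that subgroup.m_closed[OF subgroup_ker_U] by (auto simp: ker_UT_def T_ker_U)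
qed

lemma ker_UT_mem: "g \<in> ker_UT \<longleftrightarrow> g \<in> carrier G \<and> U g = \<one>\<^bsub>Q\<^esub> \<and> (\<forall>x\<in>carrier Q. T g x = 0)"
  by (auto simp: ker_UT_def ker_U_def)

lemma B_ker_UT: "g \<in> ker_UT \<Longrightarrow> h \<in> ker_UT \<Longrightarrow> x \<in> carrier Q \<Longrightarrow> B (g \<otimes> h) x = B g x + B h x"
  using B_mult[of g h x] by (auto simp: ker_UT_mem)

lemma B_ker_UT_inv: "g \<in> ker_UT \<Longrightarrow> x \<in> carrier Q \<Longrightarrow> B (inv g) x = - B g x"
  using B_ker_UT[of "inv g" g x] subgroup.m_inv_closed[OF subgroup_ker_UT, of g] B_one[of x]
  by (auto simp: ker_UT_mem)

lemma B_ker_UT_pow: "g \<in> ker_UT \<Longrightarrow> x \<in> carrier Q \<Longrightarrow> B (g [^] (n::nat)) x = n * B g x"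
proof (induction n)
  case (Suc n)
  have "g [^] n \<in> ker_UT"
    using Suc.prems(1) by (auto simp: ker_UT_def T_ker_U_pow) (auto simp: ker_U_def U.hom_nat_pow)
  then show ?case using Suc B_ker_UT[of "g [^] n" g x] by (simp add: algebra_simps)
qed (simp add: B_one)

lemma equal_ker_UT:
  assumes "g \<in> ker_UT" "h \<in> ker_UT" "\<And>x. x \<in> carrier Q \<Longrightarrow> B g x = B h x"
  shows "g = h"
proof -
  have "g \<otimes> inv h \<in> ker_UT"
    using assms subgroup_ker_UT by (meson subgroup.m_closed subgroup.m_inv_closed)
  then have "g \<otimes> inv h = \<one>"
    using assms subgroup.m_inv_closed[OF subgroup_ker_UT]
    by (intro faithful) (auto simp: ker_UT_mem B_ker_UT B_ker_UT_inv)
  then show ?thesis using assms by (simp add: ker_UT_mem) (metis inv_closed inv_equality inv_inv)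
qed

lemma comm_ker_UT: "g \<in> ker_UT \<Longrightarrow> h \<in> ker_UT \<Longrightarrow> g \<otimes> h = h \<otimes> g"
  using subgroup.m_closed[OF subgroup_ker_UT] by (intro equal_ker_UT) (auto simp: B_ker_UT)

text \<open>Conjugation by \<open>t\<close> moves a translation to another layer and so rescales it
  by a power of \<open>lam\<close>. Both the failure of nilpotency and, for \<open>lam = 2\<close>,
  that of polycyclicity come from this.\<close>

lemma conj_ker_UT:
  assumes g: "g \<in> ker_UT" and t: "t \<in> ker_U"
  shows "t \<otimes> g \<otimes> inv t \<in> ker_UT"
    and "x \<in> carrier Q \<Longrightarrow> B (t \<otimes> g \<otimes> inv t) x = lam powi (- T t x) * B g x"
proof -
  have gt: "g \<in> carrier G" "t \<in> carrier G" "g \<in> ker_U" using g t by (auto simp: ker_UT_def ker_U_def)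
  have inv: "inv t \<in> ker_U" "t \<otimes> g \<in> ker_U" "t \<otimes> g \<otimes> inv t \<in> ker_U"
    using gt t subgroup_ker_U by (simp_all add: subgroup.m_closed subgroup.m_inv_closed)
  show mem: "t \<otimes> g \<otimes> inv t \<in> ker_UT"
    using inv gt t g by (auto simp: ker_UT_def T_ker_U T_ker_U_inv)
  assume x: "x \<in> carrier Q"
  have "t \<otimes> g \<otimes> inv t \<otimes> t = t \<otimes> g" using gt by (simp add: m_assoc)
  then have "B t x + lam powi T t x * B (t \<otimes> g \<otimes> inv t) x = B g x + B t x"
    using B_mult[of "t \<otimes> g \<otimes> inv t" t x] B_mult[of t g x] gt x g t by (simp add: ker_UT_mem ker_U_def)
  then show "B (t \<otimes> g \<otimes> inv t) x = lam powi (- T t x) * B g x"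
    using lam_pos by (simp add: power_int_minus field_simps)
qed

text \<open>A finite-index subgroup contains powers of \<open>g\<close> and \<open>t\<close>. Taking
  the commutator with such a power \<open>s\<close> of \<open>t\<close> multiplies the translation
  at \<open>x\<close> by the nonzero factor \<open>1 - lam powi (- T s x)\<close>, so no term of the
  lower central series is trivial.\<close>

lemma not_virtually_nilpotent:
  assumes g: "g \<in> ker_UT" and t: "t \<in> ker_U" and x: "x \<in> carrier Q"
    and nz: "B g x \<noteq> 0" "T t x \<noteq> 0" "lam \<noteq> 1"
  shows "\<not> virtually nilpotent G"
proof
  assume "virtually nilpotent G"
  then obtain H where H: "subgroup H G" "finite (rcosets H)" "nilpotent (G\<lparr>carrier := H\<rparr>)"
    by (auto simp: virtually_def)
  define L where "L = G\<lparr>carrier := H\<rparr>"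
  have gt: "g \<in> carrier G" "t \<in> carrier G" using g t by (auto simp: ker_UT_mem ker_U_def)
  obtain n where n: "n > 0" "g [^] (n::nat) \<in> H" using finite_index_power[OF H(1,2) gt(1)] .
  obtain k where k: "k > 0" "t [^] (k::nat) \<in> H" using finite_index_power[OF H(1,2) gt(2)] .
  define s where "s = t [^] k"
  have s: "s \<in> ker_U" "s \<in> H" "s \<in> carrier G" "T s x \<noteq> 0"
    using t k x nz gt by (auto simp: s_def T_ker_U_pow) (auto simp: ker_U_def U.hom_nat_pow)
  interpret L: group L unfolding L_def using H(1) by (rule subgroup_imp_group)
  have L: "carrier L = H" by (simp add: L_def)
  have lower: "lower_central L c \<subseteq> H" for c
  proof (induction c)
    case (Suc c)
    then have "lower_central L (Suc c) \<subseteq> carrier L"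
      unfolding lower_central.simps L[symmetric] by (intro L.generate_incl) auto
    then show ?case by (simp only: L)
  qed (simp add: L)
  have "\<exists>h\<in>lower_central L c. h \<in> ker_UT \<and> B h x \<noteq> 0" for c
  proof (induction c)
    case 0
    have "g [^] n \<in> ker_UT"
      using g by (auto simp: ker_UT_def T_ker_U_pow) (auto simp: ker_U_def U.hom_nat_pow)
    then show ?case using n g x nz by (intro bexI[of _ "g [^] n"]) (auto simp: L_def B_ker_UT_pow)
  next
    case (Suc c)
    then obtain h where h: "h \<in> lower_central L c" "h \<in> ker_UT" "B h x \<noteq> 0" by blast
    have hG: "h \<in> carrier G" "h \<in> H" using h lower by (auto simp: ker_UT_mem)
    have ih: "inv h \<in> ker_UT" using h(2) subgroup.m_inv_closed[OF subgroup_ker_UT] by auto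
    have inv: "inv\<^bsub>L\<^esub> h = inv h" "inv\<^bsub>L\<^esub> s = inv s"
      using hG s H(1) by (simp_all add: L_def m_inv_consistent)
    have "h \<otimes> s \<otimes> inv h \<otimes> inv s \<in> {x \<otimes>\<^bsub>L\<^esub> y \<otimes>\<^bsub>L\<^esub> inv\<^bsub>L\<^esub> x \<otimes>\<^bsub>L\<^esub> inv\<^bsub>L\<^esub> y | x y. x \<in> lower_central L c \<and> y \<in> carrier L}"
      using h(1) s inv by (force simp: L_def)
    then have "h \<otimes> s \<otimes> inv h \<otimes> inv s \<in> lower_central L (Suc c)"
      by (auto intro: generate.incl)
    moreover have eq: "h \<otimes> s \<otimes> inv h \<otimes> inv s = h \<otimes> (s \<otimes> inv h \<otimes> inv s)"
      using hG s by (simp add: m_assoc)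
    moreover have "h \<otimes> (s \<otimes> inv h \<otimes> inv s) \<in> ker_UT"
      using h(2) conj_ker_UT(1)[OF ih s(1)] subgroup.m_closed[OF subgroup_ker_UT] by blast
    moreover have "B (h \<otimes> (s \<otimes> inv h \<otimes> inv s)) x = (1 - lam powi (- T s x)) * B h x"
      using B_ker_UT[OF h(2) conj_ker_UT(1)[OF ih s(1)] x] conj_ker_UT(2)[OF ih s(1) x] B_ker_UT_inv[OF h(2) x]
      by (simp add: algebra_simps)
    moreover have "lam powi (- T s x) \<noteq> 1"
      using powi_neq_1[of lam "- T s x"] s(4) nz(3) lam_pos by simp
    ultimately show ?case using h(3) by (intro bexI[of _ "h \<otimes> s \<otimes> inv h \<otimes> inv s"]) auto
  qed
  moreover obtain c where "lower_central L c = {\<one>}"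
    using H(3) by (auto simp: nilpotent_def L_def)
  ultimately show False using B_one[OF x] by (metis singletonD)
qed

text \<open>Bounding the denominator of the translation at \<open>x\<close> by \<open>2 ^ j\<close>
  gives an ascending chain of subgroups. It cannot become constant, because conjugation by powers of
  \<open>t\<close> or of its inverse divides \<open>B g x\<close> by arbitrarily high powers of
  2.\<close>

lemma not_polycyclic:
  assumes g: "g \<in> ker_UT" and t: "t \<in> ker_U" and x: "x \<in> carrier Q"
    and nz: "B g x \<noteq> 0" "T t x \<noteq> 0"
    and lam: "lam = 2" and R: "\<And>h. h \<in> ker_UT \<Longrightarrow> \<exists>j::nat. 2 ^ j * B h x \<in> \<int>"
  shows "\<not> polycyclic G"
proof
  assume "polycyclic G"
  define C where "C j = {h \<in> ker_UT. 2 ^ j * B h x \<in> \<int>}" for j :: nat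
  have "subgroup (C j) G" for j
  proof (rule subgroupI)
    show "C j \<subseteq> carrier G" by (auto simp: C_def ker_UT_mem)
    have "\<one> \<in> C j" using subgroup.one_closed[OF subgroup_ker_UT] by (simp add: C_def B_one[OF x])
    then show "C j \<noteq> {}" by blast
    show "inv a \<in> C j" if "a \<in> C j" for a
      using that subgroup.m_inv_closed[OF subgroup_ker_UT] by (auto simp: C_def B_ker_UT_inv[OF _ x])
    show "a \<otimes> b \<in> C j" if "a \<in> C j" "b \<in> C j" for a b
      using that subgroup.m_closed[OF subgroup_ker_UT]
      by (auto simp: C_def B_ker_UT[OF _ _ x] distrib_left)
  qed
  moreover have "C i \<subseteq> C j" if "i \<le> j" for i j
  proof
    fix h assume h: "h \<in> C i"
    then have *: "2 ^ i * B h x \<in> \<int>" by (simp add: C_def)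
    have "2 ^ (j - i) * (2 ^ i * B h x) \<in> \<int>" by (rule Ints_mult[OF _ *]) simp
    also have "2 ^ (j - i) * (2 ^ i * B h x) = 2 ^ j * B h x"
      using that by (simp flip: mult.assoc power_add)
    finally show "h \<in> C j" using h by (simp add: C_def)
  qed
  ultimately obtain j0 where j0: "\<And>j. j \<ge> j0 \<Longrightarrow> C j = C j0"
    using polycyclic_ascending_chain[OF is_group \<open>polycyclic G\<close>, of C] by blast
  have integral: "2 ^ j0 * B h x \<in> \<int>" if h: "h \<in> ker_UT" for h
  proof -
    obtain j where "2 ^ j * B h x \<in> \<int>" using R[OF h] by blast
    then have "h \<in> C j" using h by (simp add: C_def)
    then have "h \<in> C (max j j0)" using \<open>\<And>i j. i \<le> j \<Longrightarrow> C i \<subseteq> C j\<close>[of j "max j j0"] by auto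
    then show ?thesis using j0[of "max j j0"] by (auto simp: C_def)
  qed
  define s where "s = (if T t x > 0 then t else inv t)"
  have s: "s \<in> ker_U" "T s x > 0"
    using t nz subgroup.m_inv_closed[OF subgroup_ker_U] x by (auto simp: s_def T_ker_U_inv)
  define b where "b = 2 ^ j0 * B g x"
  have small: "b / 2 ^ k \<in> \<int>" for k :: nat
  proof -
    have sk: "s [^] k \<in> ker_U" using s(1) by (auto simp: ker_U_def U.hom_nat_pow)
    define h where "h = s [^] k \<otimes> g \<otimes> inv (s [^] k)"
    have "2 ^ j0 * B h x \<in> \<int>"
      unfolding h_def by (intro integral conj_ker_UT(1) g sk)
    moreover have "B h x = 2 powi (- (int k * T s x)) * B g x"
      unfolding h_def using conj_ker_UT(2)[OF g sk x] s x by (simp add: T_ker_U_pow lam)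
    \<comment> \<open>Conjugation by \<open>s [^] k\<close> divides by \<open>2 ^ k\<close> to the
      power \<open>T s x\<close>, which may exceed 1. The integer factor in front removes the
      surplus and leaves \<open>b / 2 ^ k\<close>.\<close>
    ultimately have "2 ^ (nat (int k * (T s x - 1))) * (2 ^ j0 * (2 powi (- (int k * T s x)) * B g x)) \<in> \<int>"
      using Ints_mult[OF Ints_power[OF Ints_numeral]] by metis
    also have "2 ^ (nat (int k * (T s x - 1))) = (2::real) powi (int k * (T s x - 1))"
      using s(2) by (subst power_int_of_nat[symmetric]) (simp add: nat_0_le)
    also have "2 powi (int k * (T s x - 1)) * (2 ^ j0 * (2 powi (- (int k * T s x)) * B g x)) =
        (2 powi (int k * (T s x - 1)) * 2 powi (- (int k * T s x))) * b" 
      by (simp add: b_def)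
    also have "2 powi (int k * (T s x - 1)) * 2 powi (- (int k * T s x)) = (2::real) powi (- int k)"
      by (subst power_int_add[symmetric]) (auto simp: algebra_simps)
    finally show ?thesis by (simp add: power_int_minus field_simps)
  qed
  obtain k :: nat where "\<bar>b\<bar> < 2 ^ k" using real_arch_pow[of 2 "\<bar>b\<bar>"] by auto
  then have "\<bar>b / 2 ^ k\<bar> < 1" by simp
  then have "b / 2 ^ k = 0" using small[of k] Ints_nonzero_abs_less1 by blast
  then show False using nz(1) by (simp add: b_def)
qed

end


section \<open>Solvability, polycyclicity and the existence of shifts and translations\<close>

context twisted_action
begin

text \<open>Three blocks of coordinates: those of \<open>Q\<close> modulo 2, pulled back along
  \<open>U\<close>; the integers \<open>T g x\<close>, one for each point \<open>x\<close> of
  \<open>Q\<close>, additive on \<open>ker_U\<close>; finally any \<open>n\<close> integer functions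
  additive on \<open>ker_UT\<close>.\<close>

lemma coordinates_ex:
  fixes b :: "nat \<Rightarrow> 'g \<Rightarrow> int"
  assumes cQ: "coordinates Q \<theta> (\<lambda>_. 2) L" "coordinates.level Q \<theta> (\<lambda>_. 2) L = {\<one>\<^bsub>Q\<^esub>}"
    and b: "\<And>j g h. j < n \<Longrightarrow> g \<in> ker_UT \<Longrightarrow> h \<in> ker_UT \<Longrightarrow> b j (g \<otimes> h) = b j g + b j h"
  obtains \<phi> m K where "coordinates G \<phi> m K"
    "coordinates.level G \<phi> m K = {g \<in> ker_UT. \<forall>j<n. b j g = (0::int)}"
proof -
  interpret cQ: coordinates Q \<theta> "\<lambda>_. 2" L by (rule cQ(1))
  define q where "q = card (carrier Q)"
  obtain e where e: "bij_betw e {..<q} (carrier Q)"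
    using ex_bij_betw_nat_finite[OF finite_Q] by (auto simp: q_def atLeast0LessThan)
  have e_in: "e i \<in> carrier Q" if "i < q" for i using e that by (auto simp: bij_betw_def)
  have e_surj: "\<exists>i<q. x = e i" if "x \<in> carrier Q" for x using e that by (auto simp: bij_betw_def)
  define \<phi> where "\<phi> k g = (if k < L then \<theta> k (U g) else if k < L + q then T g (e (k - L)) else b (k - (L + q)) g)" for k g
  define m where "m k = (if k < L then 2 else 0 :: int)" for k
  have low: "g \<in> ker_U" if "g \<in> carrier G" "\<And>j. j < L \<Longrightarrow> m j dvd \<phi> j g" for g
  proof -
    have "U g \<in> cQ.level L" using that by (auto simp: cQ.level_def m_def \<phi>_def)
    then show ?thesis using that cQ(2) by (simp add: ker_U_def)
  qed
  have mid: "g \<in> ker_UT" if g: "g \<in> carrier G" "\<And>j. j < L + q \<Longrightarrow> m j dvd \<phi> j g" for g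
  proof -
    have "T g (e i) = 0" if "i < q" for i using g(2)[of "L + i"] that by (simp add: m_def \<phi>_def)
    then show ?thesis using low[of g] g e_surj by (auto simp: ker_UT_def)
  qed
  have "coordinates G \<phi> m (L + q + n)"
  proof
    fix k g h
    assume k: "k < L + q + n" and g: "g \<in> carrier G" and h: "h \<in> carrier G"
      and *: "\<And>j. j < k \<Longrightarrow> m j dvd \<phi> j g" "\<And>j. j < k \<Longrightarrow> m j dvd \<phi> j h"
    consider "k < L" | "L \<le> k" "k < L + q" | "L + q \<le> k" by linarith
    then show "m k dvd \<phi> k (g \<otimes> h) - \<phi> k g - \<phi> k h"
    proof cases
      case 1
      have "2 dvd \<theta> k (U g \<otimes>\<^bsub>Q\<^esub> U h) - \<theta> k (U g) - \<theta> k (U h)"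
        using * 1 g h by (intro cQ.coord_hom) (force simp: m_def \<phi>_def)+
      then show ?thesis using 1 g h by (simp add: m_def \<phi>_def)
    next
      case 2
      then have "T (g \<otimes> h) (e (k - L)) = T g (e (k - L)) + T h (e (k - L))"
        using * g h by (intro T_ker_U low e_in) auto
      then show ?thesis using 2 by (simp add: m_def \<phi>_def)
    next
      case 3
      then have "b (k - (L + q)) (g \<otimes> h) = b (k - (L + q)) g + b (k - (L + q)) h"
        using * g h k by (intro b mid) auto
      then show ?thesis using 3 by (simp add: m_def \<phi>_def)
    qed
  qed
  moreover from this interpret coordinates G \<phi> m "L + q + n" .
  have "level (L + q + n) = {g \<in> ker_UT. \<forall>j<n. b j g = 0}"
  proof (intro equalityI subsetI)
    fix g assume g: "g \<in> level (L + q + n)"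
    then have "g \<in> ker_UT" by (intro mid) (auto simp: level_def)
    moreover have "b j g = 0" if "j < n" for j
    proof -
      have "m (L + q + j) dvd \<phi> (L + q + j) g" using g that by (auto simp: level_def)
      then show ?thesis by (simp add: m_def \<phi>_def)
    qed
    ultimately show "g \<in> {g \<in> ker_UT. \<forall>j<n. b j g = 0}" by blast
  next
    fix g assume g: "g \<in> {g \<in> ker_UT. \<forall>j<n. b j g = 0}"
    have "\<one>\<^bsub>Q\<^esub> \<in> cQ.level L" using cQ(2) by simp
    then show "g \<in> level (L + q + n)"
      using g e_in by (auto simp: level_def ker_UT_mem m_def \<phi>_def cQ.level_def)
  qed
  ultimately show thesis by (rule that)
qed

text \<open>With \<open>n = 0\<close> the third block is empty and the last level is the abelian
  group \<open>ker_UT\<close>.\<close>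

lemma solvable:
  assumes "coordinates Q \<theta> (\<lambda>_. 2) L" "coordinates.level Q \<theta> (\<lambda>_. 2) L = {\<one>\<^bsub>Q\<^esub>}"
  shows "solvable G"
proof -
  obtain \<phi> m K where *: "coordinates G \<phi> m K"
    "coordinates.level G \<phi> m K = {g \<in> ker_UT. \<forall>j<0::nat. (0::int) = 0}"
    by (rule coordinates_ex[OF assms, of 0 "\<lambda>_ _. 0"]) auto
  show ?thesis
    by (rule coordinates.solvable_if_level_comm[OF *(1)]) (auto simp: *(2) intro: comm_ker_UT)
qed

text \<open>The third block consists of the two integer coefficients of each \<open>B g x\<close>
  with respect to 1 and \<open>r\<close>. Independence of 1 and \<open>r\<close> makes these
  coefficients unique, hence additive, and they determine an element of
  \<open>ker_UT\<close>.\<close>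

lemma polycyclic:
  fixes r :: real
  assumes "coordinates Q \<theta> (\<lambda>_. 2) L" "coordinates.level Q \<theta> (\<lambda>_. 2) L = {\<one>\<^bsub>Q\<^esub>}"
    and irr: "\<And>a b. of_int a + of_int b * r = 0 \<Longrightarrow> a = 0 \<and> b = 0"
    and B: "\<And>g x. g \<in> ker_UT \<Longrightarrow> x \<in> carrier Q \<Longrightarrow> \<exists>a b. B g x = of_int a + of_int b * r"
  shows "polycyclic G"
proof -
  define c where "c g x = (SOME ab. B g x = of_int (fst ab) + of_int (snd ab) * r)" for g x
  have c: "B g x = of_int (fst (c g x)) + of_int (snd (c g x)) * r" if "g \<in> ker_UT" "x \<in> carrier Q" for g x
  proof -
    have "\<exists>ab. B g x = of_int (fst ab) + of_int (snd ab) * r" using B[OF that] by auto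
    from someI_ex[OF this] show ?thesis by (simp add: c_def)
  qed
  have unique: "a = a' \<and> b = b'" if "of_int a + of_int b * r = of_int a' + of_int b' * r" for a b a' b' :: int
    using irr[of "a - a'" "b - b'"] that by (simp add: algebra_simps)
  define q where "q = card (carrier Q)"
  obtain e where e: "bij_betw e {..<q} (carrier Q)"
    using ex_bij_betw_nat_finite[OF finite_Q] by (auto simp: q_def atLeast0LessThan)
  have e_in: "e i \<in> carrier Q" if "i < q" for i using e that by (auto simp: bij_betw_def)
  have e_surj: "\<exists>i<q. x = e i" if "x \<in> carrier Q" for x using e that by (auto simp: bij_betw_def)
  define b where "b j g = (if j < q then fst (c g (e j)) else snd (c g (e (j - q))))" for j g
  have c_add: "fst (c (g \<otimes> h) x) = fst (c g x) + fst (c h x) \<and> snd (c (g \<otimes> h) x) = snd (c g x) + snd (c h x)"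
    if "g \<in> ker_UT" "h \<in> ker_UT" "x \<in> carrier Q" for g h x
    using B_ker_UT[OF that] c[OF that(1,3)] c[OF that(2,3)]
      c[OF subgroup.m_closed[OF subgroup_ker_UT that(1,2)] that(3)]
    by (intro unique) (simp add: algebra_simps)
  have "b j (g \<otimes> h) = b j g + b j h" if "j < 2 * q" "g \<in> ker_UT" "h \<in> ker_UT" for j g h
    using that c_add[of g h "e j"] c_add[of g h "e (j - q)"] e_in[of j] e_in[of "j - q"] by (auto simp: b_def)
  then obtain \<phi> m K where *: "coordinates G \<phi> m K"
    "coordinates.level G \<phi> m K = {g \<in> ker_UT. \<forall>j<2 * q. b j g = 0}"
    by (rule coordinates_ex[OF assms(1,2)])
  interpret coordinates G \<phi> m K by (rule *(1))
  have "g = \<one>" if "g \<in> level K" for g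
  proof (rule equal_ker_UT)
    show g: "g \<in> ker_UT" using that *(2) by auto
    show "\<one> \<in> ker_UT" by (rule subgroup.one_closed[OF subgroup_ker_UT])
    fix x assume x: "x \<in> carrier Q"
    then obtain i where i: "i < q" "x = e i" using e_surj by auto
    then have "b i g = 0" "b (q + i) g = 0" using that *(2) by auto
    then show "B g x = B \<one> x" using c[OF g x] i B_one[OF x] by (simp add: b_def)
  qed
  moreover have "\<one> \<in> level K" using subgroup.one_closed[OF subgroup_level] by blast
  ultimately have "level K = {\<one>}" by blast
  then show ?thesis by (rule polycyclic_if_level_trivial)
qed

text \<open>Otherwise the subgroup acting trivially on \<open>Q\<close> is abelian, and its unique fixed points \<open>f x\<close>
  in the fibres form an invariant section, so that \<open>B\<close> is a coboundary.\<close>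

lemma translation_ex:
  assumes lam: "lam \<noteq> 1"
    and ex: "\<And>x. x \<in> carrier Q \<Longrightarrow> \<exists>t\<in>ker_U. T t x \<noteq> 0"
    and not_cob: "\<nexists>f. \<forall>g\<in>carrier G. \<forall>x\<in>carrier Q. B g x = lam powi T g x * f (U g \<otimes>\<^bsub>Q\<^esub> x) - f x"
  shows "\<exists>g\<in>ker_UT. \<exists>x\<in>carrier Q. B g x \<noteq> 0"
proof (rule ccontr)
  assume "\<not> ?thesis"
  then have triv: "g = \<one>" if "g \<in> ker_UT" for g
    using that equal_ker_UT[of g \<one>] subgroup.one_closed[OF subgroup_ker_UT] B_one by auto
  have comm: "a \<otimes> b = b \<otimes> a" if "a \<in> ker_U" "b \<in> ker_U" for a b
  proof -
    have ab: "a \<otimes> b \<in> ker_U" "b \<otimes> a \<in> ker_U" "inv (b \<otimes> a) \<in> ker_U" "a \<in> carrier G" "b \<in> carrier G"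
      using that subgroup_ker_U
      by (auto simp: subgroup.m_closed subgroup.m_inv_closed intro: subgroup.m_inv_closed subgroup.mem_carrier)
    then have "a \<otimes> b \<otimes> inv (b \<otimes> a) \<in> ker_UT"
      using that by (auto simp: ker_UT_def T_ker_U T_ker_U_inv subgroup.m_closed[OF subgroup_ker_U])
    from triv[OF this] show ?thesis using ab by (metis inv_equality inv_inv m_closed inv_closed)
  qed
  define t where "t x = (SOME t. t \<in> ker_U \<and> T t x \<noteq> 0)" for x
  have t: "t x \<in> ker_U" "T (t x) x \<noteq> 0" if "x \<in> carrier Q" for x
    using someI_ex[of "\<lambda>t. t \<in> ker_U \<and> T t x \<noteq> 0"] ex[OF that] by (auto simp: t_def)
  \<comment> \<open>In the fibre of \<open>x\<close>, the section with value
    \<open>lam powi k * c\<close> on layer \<open>k\<close> is preserved by \<open>t x\<close>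
    exactly when \<open>c\<close> is this quotient.\<close>
  define f where "f x = B (t x) x / (lam powi T (t x) x - 1)" for x
  have pow_neq_1: "lam powi i \<noteq> 1" if "i \<noteq> 0" for i
    using powi_neq_1 lam lam_pos that by blast
  \<comment> \<open>An element commuting with \<open>t x\<close> permutes the sections preserved by
    \<open>t x\<close>, and there is only one.\<close>
  have f: "B a x = (lam powi T a x - 1) * f x" if a: "a \<in> ker_U" and x: "x \<in> carrier Q" for a x
  proof -
    have "a \<otimes> t x = t x \<otimes> a" using comm a t(1)[OF x] by blast
    then have "B (t x) x + lam powi T (t x) x * B a x = B a x + lam powi T a x * B (t x) x"
      using B_mult[of a "t x" x] B_mult[of "t x" a x] a t(1)[OF x] x by (auto simp: ker_U_def)
    then have "(lam powi T (t x) x - 1) * B a x = (lam powi T a x - 1) * B (t x) x"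
      by (simp add: algebra_simps)
    then show ?thesis using pow_neq_1[OF t(2)[OF x]] by (simp add: f_def field_simps)
  qed
  have "B g x = lam powi T g x * f (U g \<otimes>\<^bsub>Q\<^esub> x) - f x" if g: "g \<in> carrier G" and x: "x \<in> carrier Q" for g x
  proof -
    define y where "y = U g \<otimes>\<^bsub>Q\<^esub> x"
    have y: "y \<in> carrier Q" using g x by (simp add: y_def)
    define a where "a = t y"
    have a: "a \<in> ker_U" "a \<in> carrier G" using t(1)[OF y] by (auto simp: a_def ker_U_def)
    \<comment> \<open>Conjugating back by \<open>g\<close> compares the preserved section over
      \<open>y\<close> with the one over \<open>x\<close>: \<open>g\<close> must carry the second to
      the first, which is the coboundary equation.\<close>
    define a' where "a' = inv g \<otimes> a \<otimes> g"
    have a': "a' \<in> ker_U" "a' \<in> carrier G"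
      using normal.inv_op_closed1[OF normal_ker_U g a(1)] by (auto simp: a'_def ker_U_def)
    have eq: "a \<otimes> g = g \<otimes> a'" using g a by (simp add: a'_def m_assoc[symmetric])
    have U: "U a = \<one>\<^bsub>Q\<^esub>" "U a' = \<one>\<^bsub>Q\<^esub>" using a a' by (auto simp: ker_U_def)
    have "T a' x = T a y"
      using T_mult[of a g x] T_mult[of g a' x] eq a a' g x U by (simp add: y_def)
    moreover have "B g x + lam powi T g x * B a y = B a' x + lam powi T a' x * B g x"
      using B_mult[of a g x] B_mult[of g a' x] eq a a' g x U by (simp add: y_def)
    ultimately have "(lam powi T a y - 1) * B g x = (lam powi T a y - 1) * (lam powi T g x * f y - f x)"
      using f[OF a(1) y] f[OF a'(1) x] by (simp add: algebra_simps)
    then show ?thesis using pow_neq_1 t(2)[OF y] by (auto simp: a_def y_def)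
  qed
  with not_cob show False by blast
qed

lemma shift_ex:
  assumes not_cob: "\<nexists>f :: 'q \<Rightarrow> int. \<forall>g\<in>carrier G. \<forall>x\<in>carrier Q. T g x = f (U g \<otimes>\<^bsub>Q\<^esub> x) - f x"
    and x: "x \<in> carrier Q"
  shows "\<exists>t\<in>ker_U. T t x \<noteq> 0"
proof (rule ccontr)
  assume neg: "\<not> ?thesis"
  have same: "T g \<one>\<^bsub>Q\<^esub> = T h \<one>\<^bsub>Q\<^esub>" if gh: "g \<in> carrier G" "h \<in> carrier G" "U g = U h" for g h
  proof -
    obtain k where k: "k \<in> carrier G" "U k = x" using U_surj x by (metis imageE)
    have "k \<otimes> (inv h \<otimes> g) \<otimes> inv k \<in> ker_U"
      using gh k x by (simp add: ker_U_def)
    then have "T (k \<otimes> (inv h \<otimes> g) \<otimes> inv k) x = 0" using neg by blast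
    moreover have "k \<otimes> (inv h \<otimes> g) \<otimes> inv k \<otimes> k = k \<otimes> (inv h \<otimes> g)"
      using gh k by (simp add: m_assoc)
    ultimately have "T (inv h \<otimes> g) \<one>\<^bsub>Q\<^esub> = 0"
      using T_mult[of "k \<otimes> (inv h \<otimes> g) \<otimes> inv k" k "\<one>\<^bsub>Q\<^esub>"] T_mult[of k "inv h \<otimes> g" "\<one>\<^bsub>Q\<^esub>"] gh k x by simp
    moreover have "h \<otimes> (inv h \<otimes> g) = g" using gh by (simp add: m_assoc[symmetric])
    ultimately show ?thesis
      using T_mult[of h "inv h \<otimes> g" "\<one>\<^bsub>Q\<^esub>"] gh by simp
  qed
  define f where "f y = T (SOME g. g \<in> carrier G \<and> U g = y) \<one>\<^bsub>Q\<^esub>" for y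
  have f: "f (U g) = T g \<one>\<^bsub>Q\<^esub>" if "g \<in> carrier G" for g
    unfolding f_def using someI[of "\<lambda>h. h \<in> carrier G \<and> U h = U g" g] that by (intro same) auto
  have "T g y = f (U g \<otimes>\<^bsub>Q\<^esub> y) - f y" if g: "g \<in> carrier G" and y: "y \<in> carrier Q" for g y
  proof -
    obtain h where h: "h \<in> carrier G" "U h = y" using U_surj y by (metis imageE)
    then show ?thesis using f[of "g \<otimes> h"] f[of h] T_mult[of g h "\<one>\<^bsub>Q\<^esub>"] g y by simp
  qed
  with not_cob show False by blast
qed

end

section \<open>The virtually abelian case\<close>

text \<open>Echelon form: a basis is collected by choosing, coordinate by coordinate, an element of the
  filtration whose next coordinate generates the group of all values of that coordinate.\<close>

theorem free_abelian_if_int_coordinates: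
  fixes G (structure) and T :: "'a \<Rightarrow> 'x \<Rightarrow> int"
  assumes "comm_group G" and X: "finite X"
    and T: "\<And>g h x. g \<in> carrier G \<Longrightarrow> h \<in> carrier G \<Longrightarrow> x \<in> X \<Longrightarrow> T (g \<otimes> h) x = T g x + T h x"
    and faithful: "\<And>g. g \<in> carrier G \<Longrightarrow> (\<And>x. x \<in> X \<Longrightarrow> T g x = 0) \<Longrightarrow> g = \<one>"
  shows "free_abelian G"
proof -
  interpret comm_group G by fact
  define lin where "lin S f = finprod G (\<lambda>s. s [^] (f s :: int)) S" for S f
  have hom: "(\<lambda>g. T g x) \<in> hom G integer_group" if "x \<in> X" for x
    using T that by (auto simp: hom_def)
  have T_hom: "group_hom G integer_group (\<lambda>g. T g x)" if "x \<in> X" for x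
    using hom[OF that] by (intro group_hom.intro group_hom_axioms.intro) auto
  have T_one: "T \<one> x = 0" if "x \<in> X" for x
    using group_hom.hom_one[OF T_hom[OF that]] by simp
  have T_pow: "T (g [^] (n::int)) x = n * T g x" if "x \<in> X" "g \<in> carrier G" for g n x
    using group_hom.hom_int_pow[OF T_hom[OF that(1)] that(2), of n] by simp
  have lin_closed: "lin S f \<in> carrier G" if "S \<subseteq> carrier G" for S f
    unfolding lin_def using that by (intro finprod_closed) auto
  have lin_insert: "lin (insert z S) f = z [^] f z \<otimes> lin S f"
    if "finite S" "z \<notin> S" "insert z S \<subseteq> carrier G" for z S f
    unfolding lin_def using that by (intro finprod_insert) auto
  have lin_cong: "lin S f = lin S g" if "\<And>s. s \<in> S \<Longrightarrow> f s = g s" "S \<subseteq> carrier G" for S f g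
    unfolding lin_def using that by (intro finprod_cong') auto
  have T_lin: "T (lin S f) x = 0" if "finite S" "S \<subseteq> carrier G" "\<And>s. s \<in> S \<Longrightarrow> T s x = 0" "x \<in> X" for S f x
    using that
  proof (induction S rule: finite_induct)
    case empty
    then show ?case by (simp add: lin_def T_one)
  next
    case (insert z S)
    then show ?case by (simp add: lin_insert T T_pow lin_closed)
  qed
  \<comment> \<open>Elements whose coordinates outside \<open>Y\<close> vanish. A basis is built
    while \<open>Y\<close> grows from the empty set to \<open>X\<close>, and uniqueness of the
    expansion is part of the induction.\<close>
  define A where "A Y = {a \<in> carrier G. \<forall>x\<in>X - Y. T a x = 0}" for Y
  have A_closed: "a \<otimes> b \<in> A Y" "inv a \<in> A Y" "a [^] (n::int) \<in> A Y" if "a \<in> A Y" "b \<in> A Y" for a b Y n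
    using that T_pow[of _ a "-1"] by (auto simp: A_def T T_pow int_pow_neg)
  define rep where "rep S a f \<longleftrightarrow> (\<forall>s. s \<notin> S \<longrightarrow> f s = (0::int)) \<and> a = lin S f" for S a f
  have "\<exists>S. finite S \<and> S \<subseteq> A Y \<and> (\<forall>a\<in>A Y. \<exists>!f. rep S a f)"
    if "Y \<subseteq> X" for Y
    using finite_subset[OF that X] that
  proof (induction Y rule: finite_induct)
    case empty
    have "A {} = {\<one>}" using faithful T_one by (auto simp: A_def)
    then show ?case
      by (intro exI[of _ "{}"]) (auto simp: rep_def lin_def fun_eq_iff)
  next
    case (insert y Y)
    then obtain S where S: "finite S" "S \<subseteq> A Y"
      "\<And>a. a \<in> A Y \<Longrightarrow> \<exists>!f. rep S a f"
      by auto
    have y: "y \<in> X" using insert by simp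
    have SG: "S \<subseteq> carrier G" using S(2) by (auto simp: A_def)
    define Y' where "Y' = insert y Y"
    have AY: "A Y = {a \<in> A Y'. T a y = 0}"
      using insert by (auto simp: A_def Y'_def)
    obtain d where d: "d \<in> (\<lambda>a. T a y) ` A Y'" "\<And>a. a \<in> (\<lambda>a. T a y) ` A Y' \<Longrightarrow> d dvd a"
    proof (rule int_subgroup_generator[of "(\<lambda>a. T a y) ` A Y'"])
      show "0 \<in> (\<lambda>a. T a y) ` A Y'"
        using T_one y by (intro image_eqI[of _ _ "\<one>"]) (auto simp: A_def)
      fix m n assume "m \<in> (\<lambda>a. T a y) ` A Y'" "n \<in> (\<lambda>a. T a y) ` A Y'"
      then obtain a b where ab: "a \<in> A Y'" "b \<in> A Y'" "m = T a y" "n = T b y" by auto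
      have "T (a \<otimes> b [^] (-1::int)) y = m - n"
        using ab y by (subst T) (auto simp: T_pow A_def)
      moreover have "a \<otimes> b [^] (-1::int) \<in> A Y'" using ab A_closed by blast
      ultimately show "m - n \<in> (\<lambda>a. T a y) ` A Y'" by (metis image_eqI)
    qed blast
    then obtain z where z: "z \<in> A Y'" "d = T z y" by auto
    have zG: "z \<in> carrier G" using z by (simp add: A_def)
    show ?case
    proof (cases "d = 0")
      case True
      then have "A Y' = A Y" using d(2) unfolding AY by auto
      then show ?thesis using S unfolding Y'_def by (intro exI[of _ S]) auto
    next
      case False
      have zS: "z \<notin> S" using False z S(2) AY by auto
      have S': "insert z S \<subseteq> carrier G" using SG zG by auto
      have T_lin_y: "T (lin (insert z S) f) y = f z * d" for f
      proof -
        have "T (lin S f) y = 0" using S AY SG y by (intro T_lin) auto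
        then show ?thesis
          using y z zG SG by (simp add: lin_insert[OF S(1) zS S'] T T_pow lin_closed)
      qed
      have "\<exists>!f. rep (insert z S) a f" if a: "a \<in> A Y'" for a
      proof -
        obtain q where q: "T a y = q * d" using d(2)[of "T a y"] a by (auto simp: dvd_def mult.commute)
        \<comment> \<open>Removing the multiple of \<open>z\<close> that accounts for the coordinate
          \<open>y\<close> leaves an element of \<open>A Y\<close>, which has its unique expansion
          by induction.\<close>
        define b where "b = a \<otimes> z [^] (- q)"
        have aG: "a \<in> carrier G" using a by (simp add: A_def)
        have "b \<in> A Y'" using a z A_closed by (auto simp: b_def)
        moreover have "T b y = 0" using aG zG y z q by (simp add: b_def T T_pow)
        ultimately have "b \<in> A Y" by (simp add: AY)
        then have ex1: "\<exists>!f. rep S b f" by (rule S(3))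
        then obtain f where "rep S b f" by blast
        then have f: "\<forall>s. s \<notin> S \<longrightarrow> f s = 0" "b = lin S f" by (auto simp: rep_def)
        have f_unique: "g = f" if "rep S b g" for g
          using ex1 \<open>rep S b f\<close> that by blast
        have ab: "a = z [^] q \<otimes> b"
          using aG zG by (simp add: b_def m_lcomm[of "z [^] q" a] int_pow_mult[symmetric])
        show ?thesis
        proof (rule ex1I[of _ "f(z := q)"])
          have "lin S (f(z := q)) = lin S f" using zS SG by (intro lin_cong) auto
          then show "rep (insert z S) a (f(z := q))"
            using f ab by (auto simp: rep_def lin_insert[OF S(1) zS S'])
        next
          fix g assume "rep (insert z S) a g"
          then have g: "(\<forall>s. s \<notin> insert z S \<longrightarrow> g s = 0) \<and> a = lin (insert z S) g" by (simp add: rep_def)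
          have "g z * d = q * d" using g T_lin_y[of g] q by simp
          then have gz: "g z = q" using False by simp
          have "lin S (g(z := 0)) = lin S g" using zS SG by (intro lin_cong) auto
          moreover have "z [^] q \<otimes> lin S g = z [^] q \<otimes> b"
            using g gz ab by (simp add: lin_insert[OF S(1) zS S'])
          ultimately have "b = lin S (g(z := 0))"
            using zG aG lin_closed[OF SG] by (simp add: b_def)
          then have "g(z := 0) = f" using g by (intro f_unique) (auto simp: rep_def)
          then show "g = f(z := q)" using gz by auto
        qed
      qed
      moreover have "insert z S \<subseteq> A Y'" using S(2) z AY by auto
      ultimately show ?thesis using S(1) unfolding Y'_def[symmetric]
        by (intro exI[of _ "insert z S"]) auto
    qed
  qed
  from this[of X] obtain S where S: "finite S" "S \<subseteq> carrier G"
    "\<And>a. a \<in> carrier G \<Longrightarrow> \<exists>!f. rep S a f"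
    by (auto simp: A_def)
  define \<Psi> where "\<Psi> p = lin S (Poly_Mapping.lookup p)" for p
  have "\<Psi> \<in> iso (free_Abelian_group S) G"
    unfolding iso_def bij_betw_def
  proof (intro CollectI conjI homI)
    show "\<Psi> p \<in> carrier G" for p unfolding \<Psi>_def using S(2) by (rule lin_closed)
    show "\<Psi> (p \<otimes>\<^bsub>free_Abelian_group S\<^esub> q) = \<Psi> p \<otimes> \<Psi> q" for p q
      using S(2) unfolding \<Psi>_def lin_def
      by (subst finprod_multf[symmetric]) (auto simp: lookup_add int_pow_mult intro!: finprod_cong')
    show "inj_on \<Psi> (carrier (free_Abelian_group S))"
    proof (rule inj_onI)
      fix p q assume pq: "p \<in> carrier (free_Abelian_group S)" "q \<in> carrier (free_Abelian_group S)" "\<Psi> p = \<Psi> q"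
      have "\<forall>s. s \<notin> S \<longrightarrow> Poly_Mapping.lookup p s = 0" "\<forall>s. s \<notin> S \<longrightarrow> Poly_Mapping.lookup q s = 0"
        using pq(1,2) by (auto simp: in_keys_iff subset_iff)
      then have "rep S (\<Psi> p) (Poly_Mapping.lookup p)" "rep S (\<Psi> p) (Poly_Mapping.lookup q)"
        using pq(3) by (simp_all add: rep_def \<Psi>_def)
      moreover have "\<exists>!f. rep S (\<Psi> p) f" unfolding \<Psi>_def by (intro S(3) lin_closed S(2))
      ultimately have "Poly_Mapping.lookup p = Poly_Mapping.lookup q" by blast
      then show "p = q" by (intro poly_mapping_eqI) simp
    qed
    show "\<Psi> ` carrier (free_Abelian_group S) = carrier G"
    proof (intro equalityI subsetI)
      fix a assume "a \<in> carrier G"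
      then obtain f where "rep S a f" using S(3) by blast
      then have f: "\<forall>s. s \<notin> S \<longrightarrow> f s = 0" "a = lin S f" by (auto simp: rep_def)
      have "finite {s. f s \<noteq> 0}" using f(1) by (intro finite_subset[OF _ S(1)]) auto
      then have look: "Poly_Mapping.lookup (Abs_poly_mapping f) = f" by simp
      then have "Abs_poly_mapping f \<in> carrier (free_Abelian_group S)"
        using f(1) by (auto simp: in_keys_iff)
      then show "a \<in> \<Psi> ` carrier (free_Abelian_group S)"
        using f(2) look by (intro image_eqI[of _ _ "Abs_poly_mapping f"]) (auto simp: \<Psi>_def)
    qed (use lin_closed[OF S(2)] in \<open>auto simp: \<Psi>_def\<close>)
  qed
  then show ?thesis
    unfolding free_abelian_def by (metis group_free_Abelian_group group.iso_sym is_isoI)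
qed

section \<open>The complex numbers as a carrier-based field\<close>

definition complex_ring :: "complex ring" where
  "complex_ring = \<lparr>carrier = UNIV, monoid.mult = (*), one = 1, zero = 0, add = (+)\<rparr>"

lemma complex_ring_simps [simp]:
  "carrier complex_ring = UNIV" "x \<otimes>\<^bsub>complex_ring\<^esub> y = x * y" "x \<oplus>\<^bsub>complex_ring\<^esub> y = x + y"
  "\<one>\<^bsub>complex_ring\<^esub> = 1" "\<zero>\<^bsub>complex_ring\<^esub> = 0"
  by (simp_all add: complex_ring_def)

lemma field_complex_ring: "field complex_ring"
proof (rule cring.cring_fieldI2)
  show "cring complex_ring"
  proof (rule cringI)
    show "abelian_group complex_ring"
      by (rule abelian_groupI) (auto simp: algebra_simps intro: exI[of _ "- x" for x])
    show "Group.comm_monoid complex_ring"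
      by (rule comm_monoidI) (auto simp: algebra_simps)
  qed (auto simp: algebra_simps)
  show "\<zero>\<^bsub>complex_ring\<^esub> \<noteq> \<one>\<^bsub>complex_ring\<^esub>" by simp
  fix a :: complex assume "a \<in> carrier complex_ring" "a \<noteq> \<zero>\<^bsub>complex_ring\<^esub>"
  then show "\<exists>b\<in>carrier complex_ring. a \<otimes>\<^bsub>complex_ring\<^esub> b = \<one>\<^bsub>complex_ring\<^esub>"
    by (intro bexI[of _ "inverse a"]) auto
qed

lemma finsum_complex_ring: "finite A \<Longrightarrow> finsum complex_ring f A = sum f A"
proof (induction A rule: finite_induct)
  case empty
  interpret field complex_ring by (rule field_complex_ring)
  show ?case using finsum_empty by simp
next
  case (insert x F)
  interpret field complex_ring by (rule field_complex_ring)
  show ?case using insert finsum_insert[of F x f] by simp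
qed

section \<open>Finite index, freeness and linearity\<close>

context twisted_action
begin

lemma ker_U_index:
  shows "finite (rcosets ker_U)" and "order Q = 2 ^ n \<Longrightarrow> \<exists>k. card (rcosets ker_U) = 2 ^ k"
proof -
  have "G Mod ker_U \<cong> Q"
    unfolding ker_U_kernel using U.FactGroup_iso U_surj by blast
  then obtain \<psi> where "bij_betw \<psi> (rcosets ker_U) (carrier Q)"
    by (auto simp: is_iso_def iso_def FactGroup_def)
  then show "finite (rcosets ker_U)" and "order Q = 2 ^ n \<Longrightarrow> \<exists>k. card (rcosets ker_U) = 2 ^ k"
    using finite_Q bij_betw_finite bij_betw_same_card unfolding order_def by metis+
qed

context
  assumes B_zero: "\<And>g x. g \<in> carrier G \<Longrightarrow> x \<in> carrier Q \<Longrightarrow> B g x = 0"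
begin

lemma comm_group_ker_U: "comm_group (G\<lparr>carrier := ker_U\<rparr>)"
proof -
  interpret A: group "G\<lparr>carrier := ker_U\<rparr>" using subgroup_ker_U by (rule subgroup_imp_group)
  show ?thesis
  proof (rule A.group_comm_groupI)
    fix a b assume "a \<in> carrier (G\<lparr>carrier := ker_U\<rparr>)" "b \<in> carrier (G\<lparr>carrier := ker_U\<rparr>)"
    then have ab: "a \<in> ker_U" "b \<in> ker_U" "a \<in> carrier G" "b \<in> carrier G" by (auto simp: ker_U_def)
    then have closed: "a \<otimes> b \<in> ker_U" "b \<otimes> a \<in> ker_U" "inv (b \<otimes> a) \<in> ker_U"
      using subgroup_ker_U by (auto simp: subgroup.m_closed intro!: subgroup.m_inv_closed)
    have "a \<otimes> b \<otimes> inv (b \<otimes> a) = \<one>"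
      using closed ab B_zero by (intro faithful) (auto simp: T_ker_U T_ker_U_inv ker_U_def)
    then show "a \<otimes>\<^bsub>G\<lparr>carrier := ker_U\<rparr>\<^esub> b = b \<otimes>\<^bsub>G\<lparr>carrier := ker_U\<rparr>\<^esub> a"
      using ab by simp (metis inv_closed inv_equality inv_inv m_closed)
  qed
qed

lemma free_abelian_ker_U: "free_abelian (G\<lparr>carrier := ker_U\<rparr>)"
proof (rule free_abelian_if_int_coordinates[OF comm_group_ker_U finite_Q, of T])
  fix g assume "g \<in> carrier (G\<lparr>carrier := ker_U\<rparr>)" "\<And>x. x \<in> carrier Q \<Longrightarrow> T g x = 0"
  then show "g = \<one>\<^bsub>G\<lparr>carrier := ker_U\<rparr>\<^esub>"
    using faithful[of g] B_zero by (auto simp: ker_U_def)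
qed (auto simp: T_ker_U)

text \<open>\<open>G\<close> acts faithfully by monomial matrices with entries \<open>2\<^bsup>T g x\<^esup>\<close>.\<close>

lemma linear_group: "linear_group G"
proof -
  define q where "q = card (carrier Q)"
  obtain e where e: "bij_betw e {..<q} (carrier Q)"
    using ex_bij_betw_nat_finite[OF finite_Q] by (auto simp: q_def atLeast0LessThan)
  have e_in: "e i \<in> carrier Q" if "i < q" for i using e that by (auto simp: bij_betw_def)
  have e_surj: "\<exists>i<q. x = e i" if "x \<in> carrier Q" for x using e that by (auto simp: bij_betw_def)
  have e_inj: "e i = e j \<longleftrightarrow> i = j" if "i < q" "j < q" for i j
    using e that by (auto simp: bij_betw_def inj_on_def)
  define F where "F g = (\<lambda>(i, j) \<in> {..<q} \<times> {..<q}.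
    if e i = U g \<otimes>\<^bsub>Q\<^esub> e j then (2::complex) powi T g (e j) else 0)" for g
  let ?M = "mat_monoid complex_ring q"
  have F_in: "F g \<in> carrier ?M" for g
    by (auto simp: mat_monoid_def F_def PiE_iff)
  have F_one: "F \<one> = \<one>\<^bsub>?M\<^esub>"
    by (rule ext) (auto simp: mat_monoid_def F_def e_in e_inj T_one restrict_def)
  have F_mult: "F (g \<otimes> h) = F g \<otimes>\<^bsub>?M\<^esub> F h" if g: "g \<in> carrier G" and h: "h \<in> carrier G" for g h
  proof (rule ext, clarify)
    fix i j
    show "F (g \<otimes> h) (i, j) = (F g \<otimes>\<^bsub>?M\<^esub> F h) (i, j)"
    proof (cases "i < q \<and> j < q")
      case True
      obtain k where k: "k < q" "U h \<otimes>\<^bsub>Q\<^esub> e j = e k" using e_surj[of "U h \<otimes>\<^bsub>Q\<^esub> e j"] e_in h True by auto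
      have "(F g \<otimes>\<^bsub>?M\<^esub> F h) (i, j) = (\<Sum>l<q. F g (i, l) * F h (l, j))"
        using True by (simp add: mat_monoid_def finsum_complex_ring)
      also have "\<dots> = (\<Sum>l<q. if l = k then F g (i, k) * F h (k, j) else 0)"
        using True k e_inj by (intro sum.cong) (auto simp: F_def)
      also have "\<dots> = F g (i, k) * F h (k, j)" using k by simp
      also have "\<dots> = F (g \<otimes> h) (i, j)"
        using True k g h e_in[of j] by (simp add: F_def T_mult power_int_add Q.m_assoc)
      finally show ?thesis by simp
    qed (auto simp: F_def mat_monoid_def restrict_def)
  qed
  have "F \<in> mon G (GL complex_ring q)"
    unfolding mon_def
  proof (intro CollectI conjI homI inj_onI)
    fix g assume g: "g \<in> carrier G"
    have "F (inv g) \<otimes>\<^bsub>?M\<^esub> F g = \<one>\<^bsub>?M\<^esub>" "F g \<otimes>\<^bsub>?M\<^esub> F (inv g) = \<one>\<^bsub>?M\<^esub>"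
      using g by (simp_all add: F_mult[symmetric] F_one)
    then show "F g \<in> carrier (GL complex_ring q)"
      using F_in by (auto simp: GL_def units_of_def Units_def)
  next
    show "F (g \<otimes> h) = F g \<otimes>\<^bsub>GL complex_ring q\<^esub> F h" if "g \<in> carrier G" "h \<in> carrier G" for g h
      using F_mult[OF that] by (simp add: GL_def units_of_def)
  next
    fix g h assume g: "g \<in> carrier G" and h: "h \<in> carrier G" and eq: "F g = F h"
    have *: "U g \<otimes>\<^bsub>Q\<^esub> x = U h \<otimes>\<^bsub>Q\<^esub> x \<and> T g x = T h x" if x: "x \<in> carrier Q" for x
    proof -
      obtain j where j: "j < q" "x = e j" using e_surj[OF x] by auto
      obtain i where i: "i < q" "U g \<otimes>\<^bsub>Q\<^esub> x = e i" using e_surj[of "U g \<otimes>\<^bsub>Q\<^esub> x"] g x by auto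
      have "F g (i, j) = F h (i, j)" using eq by simp
      then have "(2::complex) powi T g x = (if e i = U h \<otimes>\<^bsub>Q\<^esub> x then 2 powi T h x else 0)"
        using i j by (simp add: F_def)
      then have 1: "e i = U h \<otimes>\<^bsub>Q\<^esub> x" "(2::complex) powi T g x = 2 powi T h x"
        by (auto split: if_splits)
      \<comment> \<open>Norms carry the equality over to real powers of 2, where
        \<open>powi_neq_1\<close> forces equal exponents.\<close>
      then have "norm ((2::complex) powi T g x) = norm ((2::complex) powi T h x)" by simp
      then have "(2::real) powi T g x = 2 powi T h x" by (simp add: norm_power_int)
      then have "(2::real) powi (T g x - T h x) = 1" by (simp add: power_int_diff)
      then show ?thesis using 1 i powi_neq_1[of 2 "T g x - T h x"] by auto
    qed
    have gh: "inv h \<otimes> g \<in> carrier G" using g h by simp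
    have U: "U g = U h" using *[of "\<one>\<^bsub>Q\<^esub>"] g h by simp
    have "inv h \<otimes> g = \<one>"
    proof (rule faithful[OF gh])
      show "U (inv h \<otimes> g) = \<one>\<^bsub>Q\<^esub>" using U g h by simp
      show "T (inv h \<otimes> g) x = 0" if "x \<in> carrier Q" for x
      proof -
        have "h \<otimes> (inv h \<otimes> g) = g" using g h by (simp add: m_assoc[symmetric])
        then show ?thesis using T_mult[OF h gh that] *[OF that] U g h that by simp
      qed
    qed (use gh B_zero in auto)
    then show "g = h" using g h by (metis inv_equality inv_inv inv_closed)
  qed
  then show ?thesis unfolding linear_group_def using field_complex_ring by blast
qed

end

end

section \<open>Cocycles on a Cayley graph\<close>

text \<open>Stated for functions rather than coefficient vectors: the conditions on a cocycle arise
  by recursion on words, and closure properties prove them linear without computing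
  coefficients.\<close>

definition linear_form :: "real set \<Rightarrow> 'j set \<Rightarrow> (('j \<Rightarrow> real) \<Rightarrow> real) \<Rightarrow> bool" where
  "linear_form R J F \<longleftrightarrow> (\<exists>c. (\<forall>j\<in>J. c j \<in> R) \<and> (\<forall>x. F x = (\<Sum>j\<in>J. c j * x j)))"

locale real_subring =
  fixes R :: "real set"
  assumes zero_closed: "0 \<in> R" and one_closed: "1 \<in> R"
    and diff_closed: "a \<in> R \<Longrightarrow> b \<in> R \<Longrightarrow> a - b \<in> R"
    and mult_closed: "a \<in> R \<Longrightarrow> b \<in> R \<Longrightarrow> a * b \<in> R"
begin

lemma add_closed: "a \<in> R \<Longrightarrow> b \<in> R \<Longrightarrow> a + b \<in> R"
  using diff_closed[of a "0 - b"] diff_closed[OF zero_closed, of b] by simp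

lemma linear_form_zero: "linear_form R J (\<lambda>_. 0)"
  unfolding linear_form_def using zero_closed by (intro exI[of _ "\<lambda>_. 0"]) auto

lemma linear_form_add:
  assumes "linear_form R J F" "linear_form R J F'"
  shows "linear_form R J (\<lambda>x. F x + F' x)"
proof -
  obtain c c' where "\<forall>j\<in>J. c j \<in> R" "\<forall>x. F x = (\<Sum>j\<in>J. c j * x j)"
    "\<forall>j\<in>J. c' j \<in> R" "\<forall>x. F' x = (\<Sum>j\<in>J. c' j * x j)"
    using assms unfolding linear_form_def by blast
  then show ?thesis
    unfolding linear_form_def
    by (intro exI[of _ "\<lambda>j. c j + c' j"]) (auto simp: add_closed sum.distrib distrib_right)
qed

lemma linear_form_proj:
  assumes "finite J" "k \<in> J" "r \<in> R"
  shows "linear_form R J (\<lambda>x. r * x k)"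
  unfolding linear_form_def
proof (intro exI[of _ "\<lambda>j. if j = k then r else 0"] conjI allI)
  fix x
  have "(\<Sum>j\<in>J. (if j = k then r else 0) * x j) = (\<Sum>j\<in>J. if j = k then r * x j else 0)"
    by (intro sum.cong) auto
  then show "r * x k = (\<Sum>j\<in>J. (if j = k then r else 0) * x j)" using assms by simp
qed (use assms zero_closed in auto)

lemma linear_form_sum:
  "finite S \<Longrightarrow> (\<And>s. s \<in> S \<Longrightarrow> linear_form R J (F s)) \<Longrightarrow> linear_form R J (\<lambda>x. \<Sum>s\<in>S. F s x)"
  by (induction S rule: finite_induct) (auto intro: linear_form_zero linear_form_add)

lemma linear_forms_common_zero:
  assumes "finite I" "finite J" "card I < card J" "\<And>i. i \<in> I \<Longrightarrow> linear_form R J (F i)"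
  shows "\<exists>x. (\<forall>j\<in>J. x j \<in> R) \<and> (\<exists>j\<in>J. x j \<noteq> 0) \<and> (\<forall>i\<in>I. F i x = 0)"
proof -
  have "\<forall>i\<in>I. \<exists>c. (\<forall>j\<in>J. c j \<in> R) \<and> (\<forall>x. F i x = (\<Sum>j\<in>J. c j * x j))"
    using assms(4) unfolding linear_form_def by blast
  then obtain c where c: "\<forall>i\<in>I. (\<forall>j\<in>J. c i j \<in> R) \<and> (\<forall>x. F i x = (\<Sum>j\<in>J. c i j * x j))"
    by metis
  obtain x where "(\<forall>j\<in>J. x j \<in> R) \<and> (\<exists>j\<in>J. x j \<noteq> 0) \<and> (\<forall>i\<in>I. (\<Sum>j\<in>J. c i j * x j) = 0)"
    using underdetermined_solution[of R I J c, OF zero_closed one_closed diff_closed mult_closed assms(1-3)] c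
    by blast
  then show ?thesis using c by auto
qed

end

section \<open>Sums along words in a finite Cayley graph\<close>

locale involution_words = group Q for Q :: "'q monoid" (structure) +
  fixes p :: "'l::finite list \<Rightarrow> 'q"
  assumes carrier_eq: "carrier Q = range p"
    and p_append: "\<And>w v. p (w @ v) = p w \<otimes> p v"
    and p_Nil [simp]: "p [] = \<one>"
    and p_square: "\<And>s. p [s, s] = \<one>"
    and finite_carrier: "finite (carrier Q)"
begin

lemma p_closed [simp]: "p w \<in> carrier Q"
  by (simp add: carrier_eq)

lemma p_Cons: "p (s # w) = p [s] \<otimes> p w"
  using p_append[of "[s]" w] by simp

lemma p_square': "p [s] \<otimes> p [s] = \<one>"
  using p_square[of s] p_Cons[of s "[s]"] by simp

lemma letter_act_twice: "x \<in> carrier Q \<Longrightarrow> p [s] \<otimes> (p [s] \<otimes> x) = x"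
  using p_square' by (simp add: m_assoc[symmetric])

text \<open>The sum of \<open>\<tau>\<close> along the path that starts at \<open>x\<close> and
  follows the letters from the last to the first, as in a left action. In \<open>word_trans\<close>
  the edges are moreover weighted by \<open>lam\<close> to the power of the layer reached so
  far.\<close>

fun word_shift :: "('q \<Rightarrow> 'l \<Rightarrow> int) \<Rightarrow> 'l list \<Rightarrow> 'q \<Rightarrow> int" where
  "word_shift \<tau> [] x = 0"
| "word_shift \<tau> (s # w) x = word_shift \<tau> w x + \<tau> (p w \<otimes> x) s"

fun word_trans :: "real \<Rightarrow> ('q \<Rightarrow> 'l \<Rightarrow> int) \<Rightarrow> ('q \<Rightarrow> 'l \<Rightarrow> real) \<Rightarrow> 'l list \<Rightarrow> 'q \<Rightarrow> real" where
  "word_trans lam \<tau> \<delta> [] x = 0"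
| "word_trans lam \<tau> \<delta> (s # w) x =
    word_trans lam \<tau> \<delta> w x + lam powi word_shift \<tau> w x * \<delta> (p w \<otimes> x) s"

lemma word_shift_append:
  "x \<in> carrier Q \<Longrightarrow> word_shift \<tau> (w @ v) x = word_shift \<tau> v x + word_shift \<tau> w (p v \<otimes> x)"
  by (induction w) (auto simp: p_append m_assoc)

lemma word_trans_append:
  "lam > 0 \<Longrightarrow> x \<in> carrier Q \<Longrightarrow> word_trans lam \<tau> \<delta> (w @ v) x =
    word_trans lam \<tau> \<delta> v x + lam powi word_shift \<tau> v x * word_trans lam \<tau> \<delta> w (p v \<otimes> x)"
  by (induction w) (auto simp: p_append m_assoc word_shift_append power_int_add algebra_simps)

text \<open>The first power of \<open>w\<close> that acts trivially on \<open>Q\<close>; if its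
  shifts and translations vanish too, then \<open>w\<close> acts with finite order.\<close>

definition "wpow w = concat (replicate (ord (p w)) w)"

lemma p_concat_replicate: "p (concat (replicate k w)) = p w [^] k"
proof (induction k)
  case (Suc k)
  then show ?case using nat_pow_mult[of "p w" 1 k] by (simp add: p_append)
qed simp

lemma p_wpow [simp]: "p (wpow w) = \<one>"
  by (simp add: wpow_def p_concat_replicate)

lemma ord_pos: "0 < ord (p w)"
  using ord_ge_1[OF finite_carrier p_closed[of w]] by simp

lemma wpow_commute: "w @ wpow w = wpow w @ w"
proof -
  have "w @ concat (replicate k w) = concat (replicate k w) @ w" for k
    by (induction k) auto
  then show ?thesis unfolding wpow_def .
qed

definition "orb w x = {p w [^] (i::nat) \<otimes> x | i. True}"

text \<open>Left multiplication is a free action, so every orbit of \<open>p w\<close> has at least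
  \<open>ord (p w)\<close> points.\<close>

lemma card_orbits:
  "ord (p w) * card (orb w ` carrier Q) \<le> order Q"
  unfolding order_def
proof (rule card_image_fibers[OF finite_carrier])
  fix x assume x: "x \<in> carrier Q"
  let ?y = "\<lambda>i. p w [^] (i::nat) \<otimes> x"
  have "inj_on ?y {0..ord (p w) - 1}"
    using ord_inj[OF p_closed[of w]] x by (auto simp: inj_on_def)
  moreover have "{0..ord (p w) - 1} = {..<ord (p w)}" using ord_pos[of w] by auto
  moreover have "?y i \<in> {y \<in> carrier Q. orb w y = orb w x}" for i
  proof -
    have "\<exists>k::nat. p w [^] j \<otimes> x = p w [^] k \<otimes> ?y i" for j :: nat
    proof (intro exI)
      \<comment> \<open>Only natural exponents occur in \<open>orb\<close>; adding a multiple of the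
        order serves as going back by \<open>i\<close> steps.\<close>
      have "j + ord (p w) * i = (j + (ord (p w) - 1) * i) + i"
        using ord_pos[of w] by (cases "ord (p w)") auto
      then have "p w [^] (j + (ord (p w) - 1) * i) \<otimes> p w [^] i = p w [^] (j + ord (p w) * i)"
        by (simp only: nat_pow_mult p_closed)
      also have "\<dots> = p w [^] j"
        by (simp add: nat_pow_mult[symmetric] nat_pow_pow[symmetric])
      finally show "p w [^] j \<otimes> x = p w [^] (j + (ord (p w) - 1) * i) \<otimes> ?y i"
        using x by (simp add: m_assoc[symmetric])
    qed
    moreover have "\<exists>k::nat. p w [^] j \<otimes> ?y i = p w [^] k \<otimes> x" for j :: nat
      using x by (intro exI[of _ "j + i"]) (simp add: nat_pow_mult[symmetric] m_assoc)
    ultimately show ?thesis using x by (fastforce simp: orb_def)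
  qed
  then have "?y ` {..<ord (p w)} \<subseteq> {y \<in> carrier Q. orb w y = orb w x}" by blast
  ultimately show "ord (p w) \<le> card {y \<in> carrier Q. orb w y = orb w x}"
    using finite_carrier card_mono[of "{y \<in> carrier Q. orb w y = orb w x}" "?y ` {..<ord (p w)}"]
    by (simp add: card_image)
qed

text \<open>Along an orbit of \<open>p w\<close> the equations at different points are proportional, so that one equation
  per orbit is enough.\<close>

lemma word_trans_wpow_orbit:
  assumes "lam > 0" "x \<in> carrier Q" "y \<in> orb w x" "word_trans lam \<tau> \<delta> (wpow w) y = 0"
    and T: "\<And>x. x \<in> carrier Q \<Longrightarrow> word_shift \<tau> (wpow w) x = 0"
  shows "word_trans lam \<tau> \<delta> (wpow w) x = 0"
proof -
  \<comment> \<open>The words \<open>w @ wpow w\<close> and \<open>wpow w @ w\<close> coincide;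
    expanding both shows that the value at \<open>z\<close> is a power of \<open>lam\<close> times
    the value at the next point of the orbit.\<close>
  have step: "word_trans lam \<tau> \<delta> (wpow w) z = 0"
    if z: "z \<in> carrier Q" "word_trans lam \<tau> \<delta> (wpow w) (p w \<otimes> z) = 0" for z
    using word_trans_append[OF assms(1) z(1), of \<tau> \<delta> w "wpow w"]
      word_trans_append[OF assms(1) z(1), of \<tau> \<delta> "wpow w" w] z T[OF z(1)]
    by (simp add: wpow_commute)
  obtain i where i: "y = p w [^] (i::nat) \<otimes> x" using assms(3) by (auto simp: orb_def)
  have "word_trans lam \<tau> \<delta> (wpow w) (p w [^] i \<otimes> x) = 0 \<Longrightarrow> word_trans lam \<tau> \<delta> (wpow w) x = 0" for i :: nat
  proof (induction i)
    case 0
    then show ?case using assms(2) by simp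
  next
    case (Suc i)
    have "p w [^] Suc i \<otimes> x = p w \<otimes> (p w [^] i \<otimes> x)"
      using assms(2) nat_pow_mult[of "p w" 1 i] by (simp add: m_assoc[symmetric])
    then show ?case using Suc step[of "p w [^] i \<otimes> x"] assms(2) by simp
  qed
  then show ?thesis using assms(4) i by blast
qed

text \<open>For \<open>lam = 1\<close> this says that the values on the edges leaving each vertex
  sum to zero.\<close>

definition "harmonic lam \<tau> \<delta> \<longleftrightarrow>
  (\<forall>x\<in>carrier Q. (\<Sum>s\<in>UNIV. (1 + lam powi (- 2 * \<tau> x s)) * \<delta> x s) = (0::real))"

text \<open>A count of dimensions: one unknown for each directed edge, one equation for each orbit
  of each word in \<open>W\<close>, and one harmonicity equation for each vertex. The second
  assumption on \<open>W\<close> leaves more unknowns than equations.\<close>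

lemma cocycle_ex:
  assumes R: "real_subring R" "lam > 0" "\<And>k::int. lam powi k \<in> R"
    and W: "finite W" "(\<Sum>w\<in>W. card (orb w ` carrier Q)) + order Q < card (UNIV :: 'l set) * order Q"
    and T: "\<And>w x. w \<in> W \<Longrightarrow> x \<in> carrier Q \<Longrightarrow> word_shift \<tau> (wpow w) x = 0"
  obtains \<delta> where "\<And>x s. x \<in> carrier Q \<Longrightarrow> \<delta> x s \<in> R" "\<exists>x\<in>carrier Q. \<exists>s. \<delta> x s \<noteq> 0"
    "\<And>w x. w \<in> W \<Longrightarrow> x \<in> carrier Q \<Longrightarrow> word_trans lam \<tau> \<delta> (wpow w) x = 0"
    "harmonic lam \<tau> \<delta>"
proof -
  interpret R: real_subring R by fact
  define J where "J = carrier Q \<times> (UNIV :: 'l set)"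
  have J: "finite J" "card J = card (UNIV :: 'l set) * order Q"
    using finite_carrier by (auto simp: J_def order_def mult.commute)
  define I1 where "I1 = Sigma W (\<lambda>w. orb w ` carrier Q)"
  have I1: "finite I1" "card I1 = (\<Sum>w\<in>W. card (orb w ` carrier Q))"
    using W finite_carrier by (auto simp: I1_def)
  define rep where "rep O' = (SOME x. x \<in> O')" for O' :: "'q set"
  define F where "F i x = (case i of Inl (w, O') \<Rightarrow> word_trans lam \<tau> (curry x) (wpow w) (rep O')
     | Inr z \<Rightarrow> (\<Sum>s\<in>UNIV. (1 + lam powi (- 2 * \<tau> z s)) * x (z, s)))" for i x
  have rep_in: "rep (orb w x) \<in> orb w x" "rep (orb w x) \<in> carrier Q" if "x \<in> carrier Q" for w x
  proof -
    have "x \<in> orb w x" using that unfolding orb_def by (auto intro!: exI[of _ "0::nat"])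
    then show "rep (orb w x) \<in> orb w x" unfolding rep_def by (rule someI)
    then show "rep (orb w x) \<in> carrier Q" using that by (auto simp: orb_def)
  qed
  have word_form: "linear_form R J (\<lambda>x. word_trans lam \<tau> (curry x) w z)" if "z \<in> carrier Q" for w z
  proof (induction w)
    case (Cons s w)
    have "linear_form R J (\<lambda>x. lam powi word_shift \<tau> w z * x (p w \<otimes> z, s))"
      using that R(3) by (intro R.linear_form_proj J) (auto simp: J_def)
    then show ?case using R.linear_form_add[OF Cons] by simp
  qed (simp add: R.linear_form_zero)
  have "\<exists>x. (\<forall>j\<in>J. x j \<in> R) \<and> (\<exists>j\<in>J. x j \<noteq> 0) \<and> (\<forall>i\<in>I1 <+> carrier Q. F i x = 0)"
  proof (rule R.linear_forms_common_zero)
    show "finite (I1 <+> carrier Q)" "finite J" using I1 finite_carrier J by auto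
    show "card (I1 <+> carrier Q) < card J"
      using W I1 J finite_carrier by (simp add: card_Plus order_def)
    fix i assume "i \<in> I1 <+> carrier Q"
    then consider w x where "i = Inl (w, orb w x)" "x \<in> carrier Q" | z where "i = Inr z" "z \<in> carrier Q"
      by (auto simp: I1_def)
    then show "linear_form R J (F i)"
    proof cases
      case 1
      then show ?thesis unfolding F_def using word_form[OF rep_in(2)] by simp
    next
      case 2
      have "linear_form R J (\<lambda>x. \<Sum>s\<in>UNIV. (1 + lam powi (- 2 * \<tau> z s)) * x (z, s))"
        using 2 R(3) R.one_closed
        by (intro R.linear_form_sum R.linear_form_proj J R.add_closed) (auto simp: J_def)
      then show ?thesis unfolding F_def using 2 by simp
    qed
  qed
  then obtain x where x: "\<forall>j\<in>J. x j \<in> R" "\<exists>j\<in>J. x j \<noteq> 0" "\<forall>i\<in>I1 <+> carrier Q. F i x = 0"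
    by blast
  show thesis
  proof (rule that[of "curry x"])
    show "curry x z s \<in> R" if "z \<in> carrier Q" for z s
      using x(1) that by (auto simp: J_def)
    show "\<exists>z\<in>carrier Q. \<exists>s. curry x z s \<noteq> 0"
      using x(2) by (auto simp: J_def)
    show "harmonic lam \<tau> (curry x)"
      unfolding harmonic_def
    proof
      fix z assume "z \<in> carrier Q"
      then have "F (Inr z) x = 0" using x(3) by blast
      then show "(\<Sum>s\<in>UNIV. (1 + lam powi (- 2 * \<tau> z s)) * curry x z s) = 0" by (simp add: F_def)
    qed
    fix w z assume w: "w \<in> W" and z: "z \<in> carrier Q"
    then have "F (Inl (w, orb w z)) x = 0" using x(3) by (auto simp: I1_def)
    then have "word_trans lam \<tau> (curry x) (wpow w) (rep (orb w z)) = 0" by (simp add: F_def)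
    then show "word_trans lam \<tau> (curry x) (wpow w) z = 0"
      using word_trans_wpow_orbit[OF R(2) z rep_in(1)[OF z]] T[OF w] by blast
  qed
qed

text \<open>Summation by parts: the weights \<open>1 + lam powi (- 2 * \<tau> x s)\<close> in \<open>harmonic\<close> are those of the adjoint
  of the twisted coboundary operator, so that \<open>\<Sum>\<delta>\<^sup>2 = 0\<close>.\<close>

lemma harmonic_coboundary_zero:
  assumes lam: "lam > 0" and anti: "\<And>x s. x \<in> carrier Q \<Longrightarrow> \<tau> (p [s] \<otimes> x) s = - \<tau> x s"
    and cob: "\<And>x s. x \<in> carrier Q \<Longrightarrow> \<delta> x s = lam powi \<tau> x s * f (p [s] \<otimes> x) - f x"
    and harm: "harmonic lam \<tau> \<delta>" and x: "x \<in> carrier Q"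
  shows "\<delta> x s = 0"
proof -
  have anti': "\<delta> (p [s] \<otimes> x) s = - (lam powi (- \<tau> x s) * \<delta> x s)" if "x \<in> carrier Q" for x s
    using cob[of "p [s] \<otimes> x" s] cob[of x s] anti[of x s] that lam
    by (simp add: letter_act_twice power_int_minus field_simps)
  \<comment> \<open>The substitution reverses all edges labelled \<open>s\<close>; by the twisted
    antisymmetry \<open>anti'\<close> the values of \<open>f\<close> at far endpoints become values
    at near ones.\<close>
  have reindex: "(\<Sum>x\<in>carrier Q. \<delta> x s * (lam powi \<tau> x s * f (p [s] \<otimes> x))) =
      (\<Sum>x\<in>carrier Q. - (lam powi (- 2 * \<tau> x s) * \<delta> x s * f x))" for s
  proof (rule sum.reindex_bij_witness[of _ "\<lambda>x. p [s] \<otimes> x" "\<lambda>x. p [s] \<otimes> x"])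
    fix y assume y: "y \<in> carrier Q"
    show "- (lam powi (- 2 * \<tau> (p [s] \<otimes> y) s) * \<delta> (p [s] \<otimes> y) s * f (p [s] \<otimes> y)) =
        \<delta> y s * (lam powi \<tau> y s * f (p [s] \<otimes> y))"
      using lam y by (simp add: anti anti' power_int_minus power_int_mult power2_eq_square field_simps flip: power_int_add)
  qed (auto simp: letter_act_twice)
  have "(\<Sum>x\<in>carrier Q. \<Sum>s\<in>UNIV. (\<delta> x s)\<^sup>2) =
      (\<Sum>s\<in>UNIV. \<Sum>x\<in>carrier Q. \<delta> x s * (lam powi \<tau> x s * f (p [s] \<otimes> x)) - \<delta> x s * f x)"
    by (subst sum.swap, intro sum.cong refl) (simp add: power2_eq_square cob algebra_simps)
  also have "\<dots> = (\<Sum>s\<in>UNIV. \<Sum>x\<in>carrier Q. - ((1 + lam powi (- 2 * \<tau> x s)) * \<delta> x s * f x))"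
    unfolding sum_subtractf reindex unfolding sum_subtractf[symmetric]
    by (intro sum.cong refl) (simp add: algebra_simps)
  also have "\<dots> = - (\<Sum>x\<in>carrier Q. (\<Sum>s\<in>UNIV. (1 + lam powi (- 2 * \<tau> x s)) * \<delta> x s) * f x)"
    by (subst sum.swap) (simp add: sum_negf sum_distrib_right)
  also have "\<dots> = 0" using harm by (simp add: harmonic_def)
  finally have "(\<Sum>x\<in>carrier Q. \<Sum>s\<in>UNIV. (\<delta> x s)\<^sup>2) = 0" .
  then have "(\<Sum>s\<in>UNIV. (\<delta> x s)\<^sup>2) = 0"
    using x finite_carrier by (simp add: sum_nonneg_eq_0_iff sum_nonneg)
  then show ?thesis by (simp add: sum_nonneg_eq_0_iff)
qed

end

section \<open>Torsion balls\<close>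

context involution_words
begin

text \<open>Words are identified when they agree in all three components of the action.
  \<open>T2\<close> and \<open>B2\<close>, with \<open>p_square\<close>, make every letter an
  involution, and the components are read off from any representing word.\<close>

lemma twisted_group_ex:
  assumes lam: "lam > 0"
    and T2: "\<And>s x. x \<in> carrier Q \<Longrightarrow> word_shift \<tau> [s, s] x = 0"
    and B2: "\<And>s x. x \<in> carrier Q \<Longrightarrow> word_trans lam \<tau> \<delta> [s, s] x = 0"
  shows "\<exists>(G :: nat monoid) \<pi> U T B. twisted_action G Q U T B lam \<and> carrier G = range \<pi> \<and>
    (\<forall>w v. \<pi> (w @ v) = \<pi> w \<otimes>\<^bsub>G\<^esub> \<pi> v) \<and> \<pi> [] = \<one>\<^bsub>G\<^esub> \<and> (\<forall>s. \<pi> [s, s] = \<one>\<^bsub>G\<^esub>) \<and>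
    (\<forall>w. U (\<pi> w) = p w) \<and> (\<forall>w. \<forall>x\<in>carrier Q. T (\<pi> w) x = word_shift \<tau> w x) \<and>
    (\<forall>w. \<forall>x\<in>carrier Q. B (\<pi> w) x = word_trans lam \<tau> \<delta> w x)"
proof -
  define \<Phi> where "\<Phi> w = (p w, restrict (word_shift \<tau> w) (carrier Q), restrict (word_trans lam \<tau> \<delta> w) (carrier Q))" for w
  have \<Phi>_eq: "\<Phi> w = \<Phi> v \<longleftrightarrow> p w = p v \<and> (\<forall>x\<in>carrier Q. word_shift \<tau> w x = word_shift \<tau> v x) \<and>
    (\<forall>x\<in>carrier Q. word_trans lam \<tau> \<delta> w x = word_trans lam \<tau> \<delta> v x)" for w v
    unfolding \<Phi>_def by (auto simp: fun_eq_iff restrict_def)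
  have cong: "\<Phi> (w @ v) = \<Phi> (w' @ v')" if "\<Phi> w = \<Phi> w'" "\<Phi> v = \<Phi> v'" for w w' v v'
    using that lam unfolding \<Phi>_eq by (simp add: p_append word_shift_append word_trans_append)
  have invol: "\<Phi> [s, s] = \<Phi> []" for s
    unfolding \<Phi>_eq using p_square T2[of _ s] B2[of _ s] by auto
  obtain G :: "nat monoid" and \<pi> where G: "group G" "carrier G = range \<pi>"
      "\<And>w v. \<pi> (w @ v) = \<pi> w \<otimes>\<^bsub>G\<^esub> \<pi> v" "\<pi> [] = \<one>\<^bsub>G\<^esub>"
    and \<pi>_eq: "\<And>w v. \<pi> w = \<pi> v \<longleftrightarrow> \<Phi> w = \<Phi> v"
    using word_monoid_ex[of \<Phi>] cong invol by blast
  interpret G: group G by fact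
  define word where "word g = (SOME w. \<pi> w = g)" for g
  have "\<pi> (word (\<pi> w)) = \<pi> w" for w
    unfolding word_def by (rule someI) (rule refl)
  then have word: "\<Phi> (word (\<pi> w)) = \<Phi> w" for w by (simp only: \<pi>_eq)
  define U where "U g = p (word g)" for g
  define T where "T g x = word_shift \<tau> (word g) x" for g x
  define B where "B g x = word_trans lam \<tau> \<delta> (word g) x" for g x
  have UTB: "U (\<pi> w) = p w" "x \<in> carrier Q \<Longrightarrow> T (\<pi> w) x = word_shift \<tau> w x"
    "x \<in> carrier Q \<Longrightarrow> B (\<pi> w) x = word_trans lam \<tau> \<delta> w x" for w x
    using word[of w] unfolding \<Phi>_eq U_def T_def B_def by auto
  have "twisted_action G Q U T B lam"
  proof (intro twisted_action.intro twisted_action_axioms.intro G(1) is_group finite_carrier lam)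
    show "U \<in> hom G Q"
      unfolding hom_def by (auto simp: G(2) G(3)[symmetric] UTB p_append)
    show "U ` carrier G = carrier Q"
      unfolding G(2) carrier_eq image_image UTB ..
    fix g h x assume "g \<in> carrier G" "h \<in> carrier G" and x: "x \<in> carrier Q"
    then obtain w v where wv: "g = \<pi> w" "h = \<pi> v" by (auto simp: G(2))
    show "T (g \<otimes>\<^bsub>G\<^esub> h) x = T h x + T g (U h \<otimes> x)"
      "B (g \<otimes>\<^bsub>G\<^esub> h) x = B h x + lam powi T h x * B g (U h \<otimes> x)"
      unfolding wv G(3)[symmetric] using x lam by (simp_all add: UTB word_shift_append word_trans_append)
  next
    fix g assume g: "g \<in> carrier G" "U g = \<one>" "\<And>x. x \<in> carrier Q \<Longrightarrow> T g x = 0"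
      "\<And>x. x \<in> carrier Q \<Longrightarrow> B g x = 0"
    then obtain w where w: "g = \<pi> w" by (auto simp: G(2))
    have "\<Phi> w = \<Phi> []"
      unfolding \<Phi>_eq using g(2-4) by (simp add: w UTB)
    then show "g = \<one>\<^bsub>G\<^esub>" using w G(4) \<pi>_eq by metis
  qed
  moreover have "\<pi> [s, s] = \<one>\<^bsub>G\<^esub>" for s
    unfolding G(4)[symmetric] \<pi>_eq by (rule invol)
  ultimately show ?thesis using G UTB by blast
qed

end

text \<open>Every word represents a conjugate of a generator or of a cyclically reduced word that is not
  longer.\<close>

lemma word_torsion:
  fixes G (structure)
  assumes "group G" and carr: "carrier G = range \<pi>"
    and append: "\<And>w v. \<pi> (w @ v) = \<pi> w \<otimes> \<pi> v" and Nil: "\<pi> [] = \<one>" and square: "\<And>s. \<pi> [s, s] = \<one>"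
    and red: "\<And>w. distinct_adj w \<Longrightarrow> 2 \<le> length w \<Longrightarrow> length w \<le> n \<Longrightarrow> hd w \<noteq> last w \<Longrightarrow> torsion_element G (\<pi> w)"
  shows "length w \<le> n \<Longrightarrow> torsion_element G (\<pi> w)"
proof (induction "length w" arbitrary: w rule: less_induct)
  case less
  interpret group G by fact
  have \<pi>_closed: "\<pi> w \<in> carrier G" for w by (simp add: carr)
  consider "w = []" | s where "w = [s]" | u s v where "w = u @ [s, s] @ v"
    | s u where "w = s # u @ [s]" | "distinct_adj w" "2 \<le> length w" "hd w \<noteq> last w"
  proof (cases "distinct_adj w")
    case True
    show thesis
    proof (cases "2 \<le> length w")
      case True
      then obtain a u b where "w = a # u @ [b]"
        by (cases w; cases "tl w" rule: rev_cases) auto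
      then show thesis using that \<open>distinct_adj w\<close> True by (cases "a = b") auto
    next
      case False
      then show thesis using that by (cases w; cases "tl w") auto
    qed
  next
    case False
    then obtain i where i: "Suc i < length w" "w ! i = w ! Suc i"
      by (auto simp: distinct_adj_conv_nth)
    then have "w = take i w @ [w ! i, w ! i] @ drop (Suc (Suc i)) w"
      by (metis Cons_nth_drop_Suc Suc_lessD append_Cons append_Nil append_take_drop_id)
    then show thesis using that(3) by blast
  qed
  then show ?case
  proof cases
    case 1
    then show ?thesis by (auto simp: torsion_element_def Nil intro: exI[of _ "1::nat"])
  next
    case 2
    have "\<pi> [s] [^] (2::nat) = \<one>"
      using square[of s] append[of "[s]" "[s]"] \<pi>_closed by (simp add: numeral_2_eq_2)
    then show ?thesis using 2 \<pi>_closed by (auto simp: torsion_element_def intro!: exI[of _ "2::nat"])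
  next
    case 3
    then have "torsion_element G (\<pi> (u @ v))" using less by simp
    moreover have "\<pi> w = \<pi> (u @ v)"
      using 3 append[of u "[s, s] @ v"] append[of "[s, s]" v] append[of u v] square \<pi>_closed by simp
    ultimately show ?thesis by simp
  next
    case 4
    then have "torsion_element G (\<pi> u)" using less by simp
    then obtain k :: nat where k: "k > 0" "\<pi> u [^] k = \<one>" by (auto simp: torsion_element_def)
    have ss: "\<pi> [s] \<otimes> \<pi> [s] = \<one>" using square[of s] append[of "[s]" "[s]"] by simp
    have eq: "\<pi> w = \<pi> [s] \<otimes> \<pi> u \<otimes> \<pi> [s]"
      using 4 append[of "[s]" "u @ [s]"] append[of u "[s]"] \<pi>_closed by (simp add: m_assoc)
    have cancel: "\<pi> [s] \<otimes> (\<pi> [s] \<otimes> y) = y" if "y \<in> carrier G" for y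
      using ss that \<pi>_closed by (simp add: m_assoc[symmetric])
    have "\<pi> w [^] j = \<pi> [s] \<otimes> \<pi> u [^] j \<otimes> \<pi> [s]" for j :: nat
    proof (induction j)
      case (Suc j)
      then show ?case using \<pi>_closed unfolding eq by (simp add: m_assoc cancel)
    qed (use ss \<pi>_closed in simp)
    then have "\<pi> w [^] k = \<one>" using k ss \<pi>_closed by simp
    then show ?thesis using k \<pi>_closed by (auto simp: torsion_element_def)
  qed (use red less in auto)
qed

lemma involution_gens_torsion_ballI:
  fixes G :: "'a monoid" (structure) and \<pi> :: "letter list \<Rightarrow> 'a"
  assumes "group G" and carr: "carrier G = range \<pi>"
    and append: "\<And>w v. \<pi> (w @ v) = \<pi> w \<otimes> \<pi> v" and Nil: "\<pi> [] = \<one>" and square: "\<And>s. \<pi> [s, s] = \<one>"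
    and inj: "inj (\<lambda>s. \<pi> [s])" and nontriv: "\<And>s. \<pi> [s] \<noteq> \<one>"
    and torsion: "\<And>w. length w \<le> n \<Longrightarrow> torsion_element G (\<pi> w)"
  shows "involution_gens_torsion_ball n G (range (\<lambda>s. \<pi> [s]))"
  unfolding involution_gens_torsion_ball_def
proof (intro conjI ballI)
  interpret group G by fact
  let ?S = "range (\<lambda>s. \<pi> [s])"
  have \<pi>_closed: "\<pi> w \<in> carrier G" for w by (simp add: carr)
  show "group G" "?S \<subseteq> carrier G" using \<pi>_closed by auto unfold_locales
  have "\<pi> w \<in> generate G ?S" for w
  proof (induction w)
    case (Cons s w)
    then show ?case using append[of "[s]" w] by (auto intro: generate.eng generate.incl)
  qed (simp add: Nil generate.one)
  then have "carrier G \<subseteq> generate G ?S" unfolding carr by blast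
  then show "generate G ?S = carrier G"
    using generate_incl[OF \<open>?S \<subseteq> carrier G\<close>] by (rule subset_antisym[rotated])
  have "card ?S = card (UNIV :: letter set)" using inj by (rule card_image)
  then show "card ?S = 3" by (simp add: UNIV_letter)
  fix x assume "x \<in> ?S"
  then obtain s where s: "x = \<pi> [s]" by auto
  have "\<pi> [s] \<otimes> \<pi> [s] = \<one>"
    using square[of s] append[of "[s]" "[s]"] by simp
  then show "ord x = 2"
    unfolding s by (rule ord_eq_2I[OF \<pi>_closed nontriv])
next
  interpret group G by fact
  fix x assume "x \<in> word_ball G (range (\<lambda>s. \<pi> [s])) n"
  then obtain v where v: "set v \<subseteq> range (\<lambda>s. \<pi> [s])" "length v \<le> n" "x = foldr (\<otimes>) v \<one>"
    by (auto simp: word_ball_def)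
  have "\<exists>w. length w = length v \<and> foldr (\<otimes>) v \<one> = \<pi> w"
    using v(1)
  proof (induction v)
    case Nil
    then show ?case using \<open>\<pi> [] = \<one>\<close> by auto
  next
    case (Cons y v)
    then obtain w s where "length w = length v" "foldr (\<otimes>) v \<one> = \<pi> w" "y = \<pi> [s]" by auto
    then show ?case using append[of "[s]" w] by (intro exI[of _ "s # w"]) auto
  qed
  then show "torsion_element G x" using v torsion by auto
qed

section \<open>The three families\<close>

definition cyclically_reduced :: "nat \<Rightarrow> letter list set" where
  "cyclically_reduced n = {w. distinct_adj w \<and> 2 \<le> length w \<and> length w \<le> n \<and> hd w \<noteq> last w}"

lemma finite_cyclically_reduced: "finite (cyclically_reduced n)"
  by (rule finite_subset[OF _ finite_lists_length_le[of UNIV n]]) (auto simp: cyclically_reduced_def)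

text \<open>The inequality of the first and the last letter keeps the seams between copies
  reduced.\<close>

lemma distinct_adj_concat_replicate:
  assumes "distinct_adj w" "w \<noteq> []" "hd w \<noteq> last w"
  shows "distinct_adj (concat (replicate k w))"
proof (induction k)
  case (Suc k)
  then show ?case using assms
    by (cases k) (auto simp: distinct_adj_append_iff)
qed simp

text \<open>The letters are included so that the conditions on test words contain the antisymmetry
  of the cocycle. They stay apart from \<open>cyclically_reduced\<close>, because their order is
  only 2.\<close>

definition "test_words n = range (\<lambda>s. [s]) \<union> cyclically_reduced n"

text \<open>The finite data shared by all the constructions; \<open>few_orbits\<close> is the count
  that makes the systems for the cocycles underdetermined.\<close>

locale test_group = involution_words Q p
  for Q :: "nat monoid" (structure) and p :: "letter list \<Rightarrow> nat" +
  fixes n k L :: nat and \<theta> :: "nat \<Rightarrow> nat \<Rightarrow> int"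
  assumes order_eq: "order Q = 2 ^ k"
    and coord: "coordinates Q \<theta> (\<lambda>_. 2) L" "coordinates.level Q \<theta> (\<lambda>_. 2) L = {\<one>}"
    and letter_neq_one: "p [s] \<noteq> \<one>" and letter_inj: "inj (\<lambda>s. p [s])"
    and few_orbits: "(\<Sum>w\<in>test_words n. card (orb w ` carrier Q)) + order Q < 3 * order Q"

text \<open>In a 2-group faithful to reduced words shorter than \<open>n * l\<close>, the cyclically
  reduced words up to length \<open>n\<close> have order at least \<open>l\<close>. Together they
  have fewer than \<open>order Q / 2\<close> orbits, while the three letters have at most
  \<open>3 * order Q / 2\<close>.\<close>

lemma test_group_ex:
  assumes "n > 0"
  obtains Q p k L \<theta> where "test_group Q p n k L \<theta>"
proof -
  define C where "C = card (cyclically_reduced n)"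
  \<comment> \<open>Large enough for \<open>C / l < 1 / 2\<close>; being at least 3, it also keeps
    products of two different letters nontrivial.\<close>
  define l where "l = 2 * C + 3"
  have "n * l > 0" using assms by (simp add: l_def)
  then obtain Q :: "nat monoid" and p :: "letter list \<Rightarrow> nat" and \<theta> and L k
    where Q: "group Q" "carrier Q = range p" "\<And>w v. p (w @ v) = p w \<otimes>\<^bsub>Q\<^esub> p v" "p [] = \<one>\<^bsub>Q\<^esub>"
      "\<And>s. p [s, s] = \<one>\<^bsub>Q\<^esub>" "finite (carrier Q)" "order Q = 2 ^ k"
    and red: "\<And>w. distinct_adj w \<Longrightarrow> w \<noteq> [] \<Longrightarrow> length w < n * l \<Longrightarrow> p w \<noteq> \<one>\<^bsub>Q\<^esub>"
    and coord: "coordinates Q \<theta> (\<lambda>_. 2) L" "coordinates.level Q \<theta> (\<lambda>_. 2) L = {\<one>\<^bsub>Q\<^esub>}"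
    by (rule two_group_ex) blast
  have words: "involution_words Q p"
    using Q by (intro involution_words.intro involution_words_axioms.intro) auto
  then interpret involution_words Q p .
  have nl: "n * l \<ge> 3" using assms mult_le_mono[of 1 n 3 l] by (simp add: l_def)
  have letter: "p [s] \<noteq> \<one>\<^bsub>Q\<^esub>" for s using red[of "[s]"] nl by simp
  have ord_letter: "ord (p [s]) = 2" for s
    using letter p_square' by (intro ord_eq_2I) auto
  have inj: "inj (\<lambda>s. p [s])"
  proof (rule injI, rule ccontr)
    fix s r assume eq: "p [s] = p [r]" and "s \<noteq> r"
    then have "p [s, r] \<noteq> \<one>\<^bsub>Q\<^esub>" using nl by (intro red) auto
    moreover have "p [s, r] = p [s] \<otimes>\<^bsub>Q\<^esub> p [s]" unfolding eq using p_Cons[of r "[r]"] p_Cons[of s "[r]"] eq by simp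
    ultimately show False using p_square' by simp
  qed
  have ord_red: "l \<le> ord (p w)" if w: "w \<in> cyclically_reduced n" for w
  proof (rule ccontr)
    assume "\<not> l \<le> ord (p w)"
    then have "ord (p w) * n < n * l" using assms by simp
    moreover have "ord (p w) * length w \<le> ord (p w) * n" using w by (simp add: cyclically_reduced_def)
    ultimately have "ord (p w) * length w < n * l" by linarith
    moreover have "length (wpow w) = ord (p w) * length w"
      by (simp add: wpow_def length_concat sum_list_replicate)
    moreover have "distinct_adj (wpow w)"
      unfolding wpow_def using w by (intro distinct_adj_concat_replicate) (auto simp: cyclically_reduced_def)
    moreover have "wpow w \<noteq> []"
      using \<open>length (wpow w) = _\<close> ord_pos[of w] w by (auto simp: cyclically_reduced_def)
    ultimately show False using red[of "wpow w"] by simp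
  qed
  define orbs where "orbs w = card (orb w ` carrier Q)" for w
  have "order Q > 0" using Q(7) by simp
  have "orbs [s] * 2 \<le> order Q" for s
    using card_orbits[of "[s]"] by (simp add: orbs_def ord_letter)
  then have "(\<Sum>s\<in>UNIV. orbs [s]) * 2 \<le> (\<Sum>s\<in>(UNIV :: letter set). order Q)"
    unfolding sum_distrib_right by (intro sum_mono)
  then have 1: "(\<Sum>w\<in>range (\<lambda>s. [s]). orbs w) * 2 \<le> 3 * order Q"
    by (subst sum.reindex) (auto simp: UNIV_letter inj_on_def)
  have "orbs w * l \<le> order Q" if "w \<in> cyclically_reduced n" for w
    using order_trans[OF mult_le_mono1[OF ord_red[OF that]] card_orbits[of w]]
    by (simp add: orbs_def mult.commute)
  then have "(\<Sum>w\<in>cyclically_reduced n. orbs w) * l \<le> (\<Sum>w\<in>cyclically_reduced n. order Q)"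
    unfolding sum_distrib_right by (intro sum_mono)
  then have 2: "(\<Sum>w\<in>cyclically_reduced n. orbs w) * l \<le> C * order Q" by (simp add: C_def)
  have "(\<Sum>w\<in>cyclically_reduced n. orbs w) * 2 < order Q"
  proof (rule ccontr)
    assume "\<not> ?thesis"
    then have "order Q * l \<le> (\<Sum>w\<in>cyclically_reduced n. orbs w) * 2 * l" by (intro mult_le_mono1) simp
    also have "\<dots> \<le> 2 * C * order Q" using 2 by simp
    also have "\<dots> < order Q * l" using \<open>order Q > 0\<close> by (simp add: l_def)
    finally show False by simp
  qed
  moreover have "(\<Sum>w\<in>test_words n. orbs w) \<le> (\<Sum>w\<in>range (\<lambda>s. [s]). orbs w) + (\<Sum>w\<in>cyclically_reduced n. orbs w)"
    unfolding test_words_def using finite_cyclically_reduced[of n]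
    by (subst sum.union_inter[symmetric]) auto
  ultimately have "(\<Sum>w\<in>test_words n. orbs w) + order Q < 3 * order Q" using 1 by linarith
  then have "test_group Q p n k L \<theta>"
    using Q(7) coord letter inj unfolding orbs_def
    by (intro test_group.intro test_group_axioms.intro words)
  then show thesis by (rule that)
qed

text \<open>The exponent of 2 is even in \<open>a\<^sup>2\<close> and odd in
  \<open>2 * b\<^sup>2\<close>.\<close>

lemma int_sqrt2_independent:
  fixes a b :: int
  assumes "of_int a + of_int b * sqrt 2 = 0"
  shows "b = 0"
proof (rule ccontr)
  assume "b \<noteq> 0"
  have "(of_int a)\<^sup>2 = (of_int b * sqrt 2)\<^sup>2"
    using assms by (metis add_eq_0_iff2 power2_minus)
  then have "of_int (a\<^sup>2) = (of_int (2 * b\<^sup>2) :: real)" by (simp add: power_mult_distrib)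
  then have eq: "a\<^sup>2 = 2 * b\<^sup>2" by (simp only: of_int_eq_iff)
  with \<open>b \<noteq> 0\<close> have "a \<noteq> 0" by auto
  have two: "prime_elem (2::int)" by simp
  have "multiplicity 2 (a\<^sup>2) = 2 * multiplicity 2 a" "multiplicity 2 (b\<^sup>2) = 2 * multiplicity 2 b"
    using prime_elem_multiplicity_power_distrib[OF two] \<open>a \<noteq> 0\<close> \<open>b \<noteq> 0\<close> by auto
  moreover have "multiplicity 2 (2 * b\<^sup>2) = Suc (multiplicity 2 (b\<^sup>2))"
    using \<open>b \<noteq> 0\<close> by (intro multiplicity_times_same) auto
  ultimately have "2 * multiplicity 2 a = Suc (2 * multiplicity 2 b)" using eq by simp
  then show False by presburger
qed

section \<open>Cocycles and groups over a fixed finite quotient\<close>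

context test_group
begin

lemma card_letter: "card (UNIV :: letter set) = 3"
  by (simp add: UNIV_letter)

lemma finite_test_words: "finite (test_words n)"
  by (simp add: test_words_def finite_cyclically_reduced)

lemma wpow_letter: "wpow [s] = [s, s]"
proof -
  have "ord (p [s]) = 2"
    using letter_neq_one p_square' by (intro ord_eq_2I) auto
  then show ?thesis by (simp add: wpow_def numeral_2_eq_2)
qed

definition "torsion_shift \<tau> \<longleftrightarrow> (\<forall>w\<in>test_words n. \<forall>x\<in>carrier Q. word_shift \<tau> (wpow w) x = 0)"

definition "torsion_trans lam \<tau> \<delta> \<longleftrightarrow>
  (\<forall>w\<in>test_words n. \<forall>x\<in>carrier Q. word_trans lam \<tau> \<delta> (wpow w) x = 0)"

lemma torsion_shift_letter: "torsion_shift \<tau> \<Longrightarrow> x \<in> carrier Q \<Longrightarrow> word_shift \<tau> [s, s] x = 0"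
  unfolding torsion_shift_def by (metis UnI1 rangeI test_words_def wpow_letter)

lemma torsion_trans_letter: "torsion_trans lam \<tau> \<delta> \<Longrightarrow> x \<in> carrier Q \<Longrightarrow> word_trans lam \<tau> \<delta> [s, s] x = 0"
  unfolding torsion_trans_def by (metis UnI1 rangeI test_words_def wpow_letter)

lemma torsion_shift_anti:
  "torsion_shift \<tau> \<Longrightarrow> x \<in> carrier Q \<Longrightarrow> \<tau> (p [s] \<otimes> x) s = - \<tau> x s"
  using torsion_shift_letter[of \<tau> x s] by simp

text \<open>The solution provided by the count is nonzero and harmonic, whereas a harmonic
  coboundary vanishes by \<open>harmonic_coboundary_zero\<close>.\<close>

lemma torsion_trans_ex:
  assumes "real_subring R" "lam > 0" "\<And>k::int. lam powi k \<in> R" and \<tau>: "torsion_shift \<tau>"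
  shows "\<exists>\<delta>. (\<forall>x\<in>carrier Q. \<forall>s. \<delta> x s \<in> R) \<and> torsion_trans lam \<tau> \<delta> \<and>
    (\<nexists>f. \<forall>x\<in>carrier Q. \<forall>s. \<delta> x s = lam powi \<tau> x s * f (p [s] \<otimes> x) - f x)"
proof -
  have few: "(\<Sum>w\<in>test_words n. card (orb w ` carrier Q)) + order Q < card (UNIV :: letter set) * order Q"
    using few_orbits by (simp add: card_letter)
  have T: "word_shift \<tau> (wpow w) x = 0" if "w \<in> test_words n" "x \<in> carrier Q" for w x
    using that \<tau> by (simp add: torsion_shift_def)
  show ?thesis
  proof (rule cocycle_ex[OF assms(1-3) finite_test_words few T])
    fix \<delta>
    assume \<delta>: "\<And>x s. x \<in> carrier Q \<Longrightarrow> \<delta> x s \<in> R" "\<exists>x\<in>carrier Q. \<exists>s. \<delta> x s \<noteq> 0"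
      "\<And>w x. w \<in> test_words n \<Longrightarrow> x \<in> carrier Q \<Longrightarrow> word_trans lam \<tau> \<delta> (wpow w) x = 0" "harmonic lam \<tau> \<delta>"
    show ?thesis
    proof (intro exI[of _ \<delta>] conjI ballI allI \<delta>(1))
      show "torsion_trans lam \<tau> \<delta>" using \<delta>(3) by (simp add: torsion_trans_def)
      show "\<nexists>f. \<forall>x\<in>carrier Q. \<forall>s. \<delta> x s = lam powi \<tau> x s * f (p [s] \<otimes> x) - f x"
      proof
        assume "\<exists>f. \<forall>x\<in>carrier Q. \<forall>s. \<delta> x s = lam powi \<tau> x s * f (p [s] \<otimes> x) - f x"
        then obtain f where "\<And>x s. x \<in> carrier Q \<Longrightarrow> \<delta> x s = lam powi \<tau> x s * f (p [s] \<otimes> x) - f x" by blast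
        then have "\<delta> x s = 0" if "x \<in> carrier Q" for x s
          using harmonic_coboundary_zero[OF assms(2) torsion_shift_anti[OF \<tau>] _ \<delta>(4) that] by blast
        then show False using \<delta>(2) by blast
      qed
    qed
  qed
qed

text \<open>The untwisted case of \<open>torsion_trans_ex\<close>, with \<open>lam = 1\<close>, zero
  shifts and coefficients in \<open>\<int>\<close>. Taking floors only changes the type, since the
  values are integers already.\<close>

lemma torsion_shift_ex:
  obtains \<tau> where "torsion_shift \<tau>"
    "\<nexists>f :: nat \<Rightarrow> int. \<forall>x\<in>carrier Q. \<forall>s. \<tau> x s = f (p [s] \<otimes> x) - f x"
proof -
  have zero: "word_shift (\<lambda>_ _. 0) w x = 0" for w x by (induction w) auto
  have R: "real_subring \<int>" by unfold_locales auto
  obtain \<delta> where \<delta>: "\<And>x s. x \<in> carrier Q \<Longrightarrow> \<delta> x s \<in> \<int>" "torsion_trans 1 (\<lambda>_ _. 0) \<delta>"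
    "\<nexists>f. \<forall>x\<in>carrier Q. \<forall>s. \<delta> x s = f (p [s] \<otimes> x) - f x"
    using torsion_trans_ex[OF R, of 1 "\<lambda>_ _. 0"] by (auto simp: torsion_shift_def zero)
  define \<tau> where "\<tau> x s = \<lfloor>\<delta> x s\<rfloor>" for x s
  have \<tau>: "of_int (\<tau> x s) = \<delta> x s" if "x \<in> carrier Q" for x s
    using \<delta>(1)[OF that] by (simp add: \<tau>_def)
  have "of_int (word_shift \<tau> w x) = word_trans 1 (\<lambda>_ _. 0) \<delta> w x" if "x \<in> carrier Q" for w x
    using that by (induction w) (auto simp: \<tau>)
  then have "torsion_shift \<tau>"
    using \<delta>(2) unfolding torsion_shift_def torsion_trans_def by (metis of_int_eq_0_iff)
  moreover have "\<nexists>f :: nat \<Rightarrow> int. \<forall>x\<in>carrier Q. \<forall>s. \<tau> x s = f (p [s] \<otimes> x) - f x"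
  proof
    assume "\<exists>f :: nat \<Rightarrow> int. \<forall>x\<in>carrier Q. \<forall>s. \<tau> x s = f (p [s] \<otimes> x) - f x"
    then obtain f :: "nat \<Rightarrow> int" where "\<forall>x\<in>carrier Q. \<forall>s. \<tau> x s = f (p [s] \<otimes> x) - f x" by blast
    then have "\<forall>x\<in>carrier Q. \<forall>s. \<delta> x s = of_int (f (p [s] \<otimes> x)) - of_int (f x)"
      by (metis \<tau> of_int_diff)
    then show False using \<delta>(3) by (metis comp_apply)
  qed
  ultimately show thesis by (rule that)
qed

text \<open>For a test word, \<open>wpow\<close> acts trivially in all three components and is
  therefore trivial by faithfulness; \<open>word_torsion\<close> extends this to the whole ball. The
  last conjunct serves to bound the values of \<open>B\<close> to a ring.\<close>

lemma torsion_group_ex: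
  assumes lam: "lam > 0" and \<tau>: "torsion_shift \<tau>" and \<delta>: "torsion_trans lam \<tau> \<delta>"
  shows "\<exists>(G :: nat monoid) S U T B. twisted_action G Q U T B lam \<and> involution_gens_torsion_ball n G S \<and>
    (\<forall>s. \<exists>g\<in>carrier G. U g = p [s] \<and> (\<forall>x\<in>carrier Q. T g x = \<tau> x s \<and> B g x = \<delta> x s)) \<and>
    (\<forall>g\<in>carrier G. \<exists>w. \<forall>x\<in>carrier Q. B g x = word_trans lam \<tau> \<delta> w x)"
proof -
  obtain G :: "nat monoid" and \<pi> U T B where act: "twisted_action G Q U T B lam"
    and G: "carrier G = range \<pi>" "\<And>w v. \<pi> (w @ v) = \<pi> w \<otimes>\<^bsub>G\<^esub> \<pi> v" "\<pi> [] = \<one>\<^bsub>G\<^esub>" "\<And>s. \<pi> [s, s] = \<one>\<^bsub>G\<^esub>"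
    and U: "\<And>w. U (\<pi> w) = p w" and T: "\<And>w x. x \<in> carrier Q \<Longrightarrow> T (\<pi> w) x = word_shift \<tau> w x"
    and B: "\<And>w x. x \<in> carrier Q \<Longrightarrow> B (\<pi> w) x = word_trans lam \<tau> \<delta> w x"
    using twisted_group_ex[OF lam torsion_shift_letter[OF \<tau>] torsion_trans_letter[OF \<delta>]] by metis
  interpret A: twisted_action G Q U T B lam by (rule act)
  have \<pi>_closed: "\<pi> w \<in> carrier G" for w using G(1) by simp
  have pow: "\<pi> w [^]\<^bsub>G\<^esub> j = \<pi> (concat (replicate j w))" for w and j :: nat
  proof (induction j)
    case (Suc j)
    have "\<pi> w [^]\<^bsub>G\<^esub> Suc j = \<pi> w \<otimes>\<^bsub>G\<^esub> \<pi> w [^]\<^bsub>G\<^esub> j" using A.nat_pow_mult[of "\<pi> w" 1 j] \<pi>_closed by simp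
    then show ?case using Suc G(2) by simp
  qed (simp add: G(3))
  have test: "torsion_element G (\<pi> w)" if w: "w \<in> test_words n" for w
  proof -
    have "\<pi> (wpow w) = \<one>\<^bsub>G\<^esub>"
      using w \<tau> \<delta> \<pi>_closed by (intro A.faithful) (auto simp: U T B torsion_shift_def torsion_trans_def)
    then show ?thesis
      using ord_pos[of w] pow \<pi>_closed unfolding torsion_element_def wpow_def by metis
  qed
  have torsion: "torsion_element G (\<pi> w)" if "length w \<le> n" for w
  proof (rule word_torsion[OF A.is_group G _ that])
    fix v :: "letter list"
    assume "distinct_adj v" "2 \<le> length v" "length v \<le> n" "hd v \<noteq> last v"
    then show "torsion_element G (\<pi> v)"
      by (intro test) (simp add: test_words_def cyclically_reduced_def)
  qed
  have "involution_gens_torsion_ball n G (range (\<lambda>s. \<pi> [s]))"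
  proof (rule involution_gens_torsion_ballI[OF A.is_group G _ _ torsion])
    have "p [s] = p [r]" if "\<pi> [s] = \<pi> [r]" for s r using that U by metis
    then show "inj (\<lambda>s. \<pi> [s])" using letter_inj by (meson injD injI)
    show "\<pi> [s] \<noteq> \<one>\<^bsub>G\<^esub>" for s using letter_neq_one[of s] U[of "[s]"] U[of "[]"] G(3) by auto
  qed
  moreover have "\<exists>g\<in>carrier G. U g = p [s] \<and> (\<forall>x\<in>carrier Q. T g x = \<tau> x s \<and> B g x = \<delta> x s)" for s
    by (intro bexI[of _ "\<pi> [s]"] \<pi>_closed) (simp add: U T B)
  moreover have "\<exists>w. \<forall>x\<in>carrier Q. B g x = word_trans lam \<tau> \<delta> w x" if "g \<in> carrier G" for g
    using that B by (auto simp: G(1))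
  ultimately show ?thesis using act by blast
qed

text \<open>The second cocycle is zero, so only the action on \<open>Q \<times> \<int>\<close>
  remains. The group is infinite because the first cocycle is no coboundary: some \<open>t\<close>
  in \<open>ker_U\<close> has a nonzero shift, and the shifts of its powers are all
  different.\<close>

lemma virtually_abelian_group_ex:
  "\<exists>(G :: nat monoid) S. involution_gens_torsion_ball n G S \<and>
    solvable G \<and> virtually comm_group G \<and> infinite (carrier G) \<and>
    (\<exists>A. A \<lhd> G \<and> free_abelian (G\<lparr>carrier := A\<rparr>) \<and>
         finite (rcosets\<^bsub>G\<^esub> A) \<and> (\<exists>k::nat. card (rcosets\<^bsub>G\<^esub> A) = 2 ^ k)) \<and>
    linear_group G"
proof -
  obtain \<tau> where \<tau>: "torsion_shift \<tau>"
    "\<nexists>f :: nat \<Rightarrow> int. \<forall>x\<in>carrier Q. \<forall>s. \<tau> x s = f (p [s] \<otimes> x) - f x"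
    by (rule torsion_shift_ex)
  have zero: "word_trans 1 \<tau> (\<lambda>_ _. 0) w x = 0" for w x by (induction w) auto
  obtain G :: "nat monoid" and S U T B where act: "twisted_action G Q U T B 1"
    and ball: "involution_gens_torsion_ball n G S"
    and gens: "\<And>s. \<exists>g\<in>carrier G. U g = p [s] \<and> (\<forall>x\<in>carrier Q. T g x = \<tau> x s \<and> B g x = 0)"
    and B: "\<And>g x. g \<in> carrier G \<Longrightarrow> x \<in> carrier Q \<Longrightarrow> B g x = 0"
    using torsion_group_ex[of 1 \<tau> "\<lambda>_ _. 0"] \<tau>(1) by (auto simp: zero torsion_trans_def)
  interpret A: twisted_action G Q U T B 1 by (rule act)
  have "\<nexists>f :: nat \<Rightarrow> int. \<forall>g\<in>carrier G. \<forall>x\<in>carrier Q. T g x = f (U g \<otimes> x) - f x"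
    using \<tau>(2) gens by metis
  from A.shift_ex[OF this one_closed] obtain t where t: "t \<in> A.ker_U" "T t \<one> \<noteq> 0" by blast
  have "inj (\<lambda>j::nat. t [^]\<^bsub>G\<^esub> j)"
  proof (rule injI)
    fix i j :: nat assume "t [^]\<^bsub>G\<^esub> i = t [^]\<^bsub>G\<^esub> j"
    then have "int i * T t \<one> = int j * T t \<one>"
      using A.T_ker_U_pow[OF t(1) one_closed] by metis
    then show "i = j" using t(2) by simp
  qed
  moreover have "range (\<lambda>j::nat. t [^]\<^bsub>G\<^esub> j) \<subseteq> carrier G" using t(1) by (auto simp: A.ker_U_def)
  ultimately have inf: "infinite (carrier G)" using finite_subset range_inj_infinite by blast
  obtain j where "card (rcosets\<^bsub>G\<^esub> A.ker_U) = 2 ^ j" using A.ker_U_index(2)[OF order_eq] by blast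
  moreover have "virtually comm_group G"
    unfolding virtually_def using A.subgroup_ker_U A.ker_U_index(1) A.comm_group_ker_U[OF B] by blast
  ultimately show ?thesis
    using ball A.solvable[OF coord] inf A.normal_ker_U A.free_abelian_ker_U[OF B] A.ker_U_index(1)
      A.linear_group[OF B] by blast
qed

text \<open>The common core of the two remaining cases, which differ in the choice of
  \<open>lam\<close> and of the ring \<open>R\<close> of coefficients.\<close>

lemma twisted_torsion_group_ex:
  assumes R: "real_subring R" "\<And>k::int. lam powi k \<in> R" and lam: "lam > 0" "lam \<noteq> 1"
  shows "\<exists>(G :: nat monoid) S U T B. twisted_action G Q U T B lam \<and> involution_gens_torsion_ball n G S \<and>
    (\<exists>g\<in>twisted_action.ker_UT G Q U T. \<exists>t\<in>twisted_action.ker_U G Q U. \<exists>x\<in>carrier Q. B g x \<noteq> 0 \<and> T t x \<noteq> 0) \<and>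
    (\<forall>g\<in>carrier G. \<forall>x\<in>carrier Q. B g x \<in> R)"
proof -
  interpret R: real_subring R by fact
  obtain \<tau> where \<tau>: "torsion_shift \<tau>"
    "\<nexists>f :: nat \<Rightarrow> int. \<forall>x\<in>carrier Q. \<forall>s. \<tau> x s = f (p [s] \<otimes> x) - f x"
    by (rule torsion_shift_ex)
  obtain \<delta> where \<delta>: "\<And>x s. x \<in> carrier Q \<Longrightarrow> \<delta> x s \<in> R" "torsion_trans lam \<tau> \<delta>"
    "\<nexists>f. \<forall>x\<in>carrier Q. \<forall>s. \<delta> x s = lam powi \<tau> x s * f (p [s] \<otimes> x) - f x"
    using torsion_trans_ex[OF R(1) lam(1) R(2) \<tau>(1)] by blast
  obtain G :: "nat monoid" and S U T B where act: "twisted_action G Q U T B lam"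
    and ball: "involution_gens_torsion_ball n G S"
    and gens: "\<And>s. \<exists>g\<in>carrier G. U g = p [s] \<and> (\<forall>x\<in>carrier Q. T g x = \<tau> x s \<and> B g x = \<delta> x s)"
    and B: "\<And>g. g \<in> carrier G \<Longrightarrow> \<exists>w. \<forall>x\<in>carrier Q. B g x = word_trans lam \<tau> \<delta> w x"
    using torsion_group_ex[OF lam(1) \<tau>(1) \<delta>(2)] by blast
  interpret A: twisted_action G Q U T B lam by (rule act)
  have "\<nexists>f :: nat \<Rightarrow> int. \<forall>g\<in>carrier G. \<forall>x\<in>carrier Q. T g x = f (U g \<otimes> x) - f x"
    using \<tau>(2) gens by metis
  note t = A.shift_ex[OF this]
  \<comment> \<open>A potential for the whole group would restrict, on the generators, to one for
    \<open>\<delta>\<close>.\<close>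
  have "\<nexists>f. \<forall>g\<in>carrier G. \<forall>x\<in>carrier Q. B g x = lam powi T g x * f (U g \<otimes> x) - f x"
    using \<delta>(3) gens by metis
  from A.translation_ex[OF lam(2) t this] obtain g x
    where g: "g \<in> A.ker_UT" "x \<in> carrier Q" "B g x \<noteq> 0" by blast
  obtain u where u: "u \<in> A.ker_U" "T u x \<noteq> 0" using t g(2) by blast
  have word_R: "word_trans lam \<tau> \<delta> w x \<in> R" if "x \<in> carrier Q" for w x
    using that by (induction w) (auto intro!: R.zero_closed R.add_closed R.mult_closed R(2) \<delta>(1))
  have B_R: "B g x \<in> R" if "g \<in> carrier G" "x \<in> carrier Q" for g x
  proof -
    obtain w where "\<forall>x\<in>carrier Q. B g x = word_trans lam \<tau> \<delta> w x" using B \<open>g \<in> carrier G\<close> by blast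
    then show ?thesis using word_R \<open>x \<in> carrier Q\<close> by simp
  qed
  show ?thesis
    by (intro exI[of _ G] exI[of _ S] exI[of _ U] exI[of _ T] exI[of _ B] conjI act ball
        bexI[OF _ g(1)] bexI[OF _ u(1)] bexI[OF _ g(2)] g(3) u(2) ballI B_R)
qed

text \<open>\<open>1 + sqrt 2\<close> is a unit of the ring \<open>\<int>[sqrt 2]\<close>, so this
  ring contains all its integer powers; its additive group has the finite basis 1,
  \<open>sqrt 2\<close>, as \<open>A.polycyclic\<close> demands.\<close>

lemma polycyclic_group_ex:
  "\<exists>(G :: nat monoid) S. involution_gens_torsion_ball n G S \<and> polycyclic G \<and> \<not> virtually nilpotent G"
proof -
  define R where "R = {x. \<exists>a b. x = of_int a + of_int b * sqrt 2}"
  have RI: "of_int a + of_int b * sqrt 2 \<in> R" for a b by (auto simp: R_def)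
  interpret R: real_subring R
  proof
    show "0 \<in> R" "1 \<in> R" using RI[of 0 0] RI[of 1 0] by simp_all
    fix x y assume "x \<in> R" "y \<in> R"
    then obtain a b c d where xy: "x = of_int a + of_int b * sqrt 2" "y = of_int c + of_int d * sqrt 2"
      by (auto simp: R_def)
    show "x - y \<in> R" using RI[of "a - c" "b - d"] by (simp add: xy algebra_simps)
    show "x * y \<in> R" using RI[of "a * c + 2 * b * d" "a * d + b * c"] by (simp add: xy algebra_simps)
  qed
  define lam where "lam = 1 + sqrt 2"
  have lam: "lam > 0" "lam \<noteq> 1" by (simp_all add: lam_def add_pos_nonneg)
  have pow: "x ^ j \<in> R" if "x \<in> R" for x and j :: nat
    using that by (induction j) (auto intro: R.one_closed R.mult_closed)
  have inv: "inverse lam = - 1 + sqrt 2"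
    by (rule inverse_unique) (simp add: lam_def algebra_simps)
  have powi: "lam powi k \<in> R" for k
    using pow[of lam "nat k"] pow[of "inverse lam" "nat (- k)"] RI[of 1 1] RI[of "-1" 1]
    by (simp add: power_int_def inv) (simp add: lam_def)
  obtain G :: "nat monoid" and S U T B where act: "twisted_action G Q U T B lam"
    and ball: "involution_gens_torsion_ball n G S"
    and ex: "\<exists>g\<in>twisted_action.ker_UT G Q U T. \<exists>t\<in>twisted_action.ker_U G Q U. \<exists>x\<in>carrier Q. B g x \<noteq> 0 \<and> T t x \<noteq> 0"
    and B: "\<forall>g\<in>carrier G. \<forall>x\<in>carrier Q. B g x \<in> R"
    using twisted_torsion_group_ex[OF R.real_subring_axioms powi lam] by blast
  interpret A: twisted_action G Q U T B lam by (rule act)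
  have "polycyclic G"
  proof (rule A.polycyclic[OF coord, of "sqrt 2"])
    fix a b :: int assume ab: "of_int a + of_int b * sqrt 2 = 0"
    then have "b = 0" by (rule int_sqrt2_independent)
    then show "a = 0 \<and> b = 0" using ab by simp
  next
    show "\<exists>a b. B g x = of_int a + of_int b * sqrt 2" if "g \<in> A.ker_UT" "x \<in> carrier Q" for g x
      using B that by (auto simp: R_def A.ker_UT_mem)
  qed
  moreover have "\<not> virtually nilpotent G" using ex A.not_virtually_nilpotent lam by blast
  ultimately show ?thesis using ball by blast
qed

text \<open>Here \<open>R\<close> is the ring of dyadic rationals, which contains all integer powers
  of 2; membership in \<open>R\<close> is the condition on denominators in
  \<open>A.not_polycyclic\<close>.\<close>

lemma not_polycyclic_group_ex:
  "\<exists>(G :: nat monoid) S. involution_gens_torsion_ball n G S \<and> solvable G \<and> \<not> polycyclic G"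
proof -
  define R :: "real set" where "R = {x. \<exists>j::nat. 2 ^ j * x \<in> \<int>}"
  have RI: "x \<in> R" if "2 ^ j * x \<in> \<int>" for x and j :: nat using that by (auto simp: R_def)
  interpret R: real_subring R
  proof
    show "0 \<in> R" "1 \<in> R" by (rule RI[of 0]; simp)+
    fix x y assume "x \<in> R" "y \<in> R"
    then obtain i j where ij: "2 ^ i * x \<in> \<int>" "2 ^ j * y \<in> \<int>" by (auto simp: R_def)
    have "2 ^ j * (2 ^ i * x) - 2 ^ i * (2 ^ j * y) \<in> \<int>"
      by (rule Ints_diff; rule Ints_mult[OF _ ij(1)] Ints_mult[OF _ ij(2)]; simp)
    then show "x - y \<in> R" by (intro RI[of "i + j"]) (simp add: power_add algebra_simps)
    have "(2 ^ i * x) * (2 ^ j * y) \<in> \<int>" using ij by (rule Ints_mult)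
    then show "x * y \<in> R" by (intro RI[of "i + j"]) (simp add: power_add algebra_simps)
  qed
  have powi: "2 powi k \<in> R" for k
  proof (rule RI[of "nat (- k)"])
    have "2 ^ nat (- k) * 2 powi k = (2::real) ^ nat k"
      by (auto simp: power_int_def power_inverse simp flip: power_mult_distrib)
    then show "2 ^ nat (- k) * 2 powi k \<in> (\<int> :: real set)" by simp
  qed
  have two: "(2::real) > 0" "(2::real) \<noteq> 1" by simp_all
  obtain G :: "nat monoid" and S U T B where act: "twisted_action G Q U T B 2"
    and ball: "involution_gens_torsion_ball n G S"
    and ex: "\<exists>g\<in>twisted_action.ker_UT G Q U T. \<exists>t\<in>twisted_action.ker_U G Q U. \<exists>x\<in>carrier Q. B g x \<noteq> 0 \<and> T t x \<noteq> 0"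
    and B: "\<forall>g\<in>carrier G. \<forall>x\<in>carrier Q. B g x \<in> R"
    using twisted_torsion_group_ex[OF R.real_subring_axioms powi two] by blast
  interpret A: twisted_action G Q U T B 2 by (rule act)
  obtain g t x where *: "g \<in> A.ker_UT" "t \<in> A.ker_U" "x \<in> carrier Q" "B g x \<noteq> 0" "T t x \<noteq> 0"
    using ex by blast
  have "\<not> polycyclic G"
    using B *(3) by (intro A.not_polycyclic[OF *]) (auto simp: R_def A.ker_UT_mem)
  then show ?thesis using ball A.solvable[OF coord] by blast
qed

end

theorem proposition1:
  fixes n :: nat
  assumes "n > 0"
  shows "(\<exists>(G :: nat monoid) S. involution_gens_torsion_ball n G S \<and>
            solvable G \<and> virtually comm_group G \<and> infinite (carrier G) \<and>
            (\<exists>A. A \<lhd> G \<and> free_abelian (G\<lparr>carrier := A\<rparr>) \<and>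
                 finite (rcosets\<^bsub>G\<^esub> A) \<and> (\<exists>k::nat. card (rcosets\<^bsub>G\<^esub> A) = 2 ^ k)) \<and>
            linear_group G)
       \<and> (\<exists>(G :: nat monoid) S. involution_gens_torsion_ball n G S \<and>
            polycyclic G \<and> \<not> virtually nilpotent G)
       \<and> (\<exists>(G :: nat monoid) S. involution_gens_torsion_ball n G S \<and>
            solvable G \<and> \<not> polycyclic G)"
proof -
  \<comment> \<open>One finite group \<open>Q\<close> serves all three cases; only
    \<open>lam\<close> and the second cocycle vary.\<close>
  obtain Q p k L \<theta> where "test_group Q p n k L \<theta>"
    using assms by (rule test_group_ex)
  then interpret test_group Q p n k L \<theta> .
  show ?thesis
    using virtually_abelian_group_ex polycyclic_group_ex not_polycyclic_group_ex by blast
qed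

end
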